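(* Let $\mathcal{M}=(E,\mathcal{I})$ be any laminar matroid on a finite ground set $E$, and let $w:E\to\mathbb{R}_{>0}$ be any weight function with pairwise distinct weights. Let each element $e\in E$ have an arrival time drawn independently and uniformly at random from $[0,1]$, and run the Greedy algorithm with threshold $t_0=0.7$. Then for every element $e^*\in OPT$, the probability (over the random arrival times) that Greedy selects $e^*$ is at least $\frac{1}{4.75}$. In particular, Greedy with $t_0=0.7$ is $4.75$ probability-competitive for the Laminar Matroid Secretary Problem.
   Context: A matroid $\mathcal{M}=(E,\mathcal{I})$ consists of a finite set $E$ and a family $\mathcal{I}\subseteq 2^E$ of independent sets with $\emptyset\in\mathcal{I}$, closed under subsets, and satisfying augmentation (if $S,T\in\mathcal{I}$, $|S|>|T|$, then $T\cup\{e\}\in\mathcal{I}$ for some $e\in S\setminus T$). A laminar family $\mathcal{F}$ over $E$ is a collection of subsets of $E$ such that any two distinct members are either nested or disjoint. A laminar matroid is given by a laminar family $\mathcal{F}$ and capacities $c(B)\in\mathbb{Z}_{\ge 0}$ for $B\in\mathcal{F}$; a set $S\subseteq E$ is independent iff $|S\cap B|\le c(B)$ for all $B\in\mathcal{F}$. Weights are assumed pairwise distinct, so for every $S\subseteq E$ the maximum-weight independent subset of $S$ (the optimal solution of the restriction $\mathcal{M}_S=(S,\mathcal{I}\cap 2^S)$) is unique. For $t\in[0,1]$, let $E(t)$ be the set of elements whose arrival time lies in $[0,t]$, let $OPT(t)$ be the maximum-weight independent subset of $E(t)$, and let $OPT=OPT(1)$ be the maximum-weight independent subset of $E$. Greedy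 algorithm with threshold $t_0$: the elements are revealed in increasing order of arrival time; when element $e$ arrives at time $t$ (its weight being revealed), the algorithm must irrevocably decide whether to select it. Starting with $ALG=\emptyset$, it adds $e$ to $ALG$ if and only if (1) $t>t_0$, (2) $e\in OPT(t)$, and (3) $ALG\cup\{e\}\in\mathcal{I}$. An algorithm is $c$ probability-competitive if every element of $OPT$ is selected with probability at least $1/c$. *)

theory Defs
  imports "HOL-Probability.Probability"
begin

definition matroid :: "'a set \<Rightarrow> 'a set set \<Rightarrow> bool" where
  "matroid E \<I> \<longleftrightarrow>
     finite E \<and> \<I> \<subseteq> Pow E \<and> {} \<in> \<I> \<and>
     (\<forall>S\<in>\<I>. \<forall>T. T \<subseteq> S \<longrightarrow> T \<in> \<I>) \<and>
     (\<forall>S\<in>\<I>. \<forall>T\<in>\<I>. card S > card T \<longrightarrow> (\<exists>e\<in>S - T. insert e T \<in> \<I>))"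

definition laminar_family :: "'a set \<Rightarrow> 'a set set \<Rightarrow> bool" where
  "laminar_family E \<F> \<longleftrightarrow>
     \<F> \<subseteq> Pow E \<and>
     (\<forall>A\<in>\<F>. \<forall>B\<in>\<F>. A \<noteq> B \<longrightarrow> A \<subseteq> B \<or> B \<subseteq> A \<or> A \<inter> B = {})"

definition laminar_indep :: "'a set \<Rightarrow> 'a set set \<Rightarrow> ('a set \<Rightarrow> nat) \<Rightarrow> 'a set set" where
  "laminar_indep E \<F> c = {S. S \<subseteq> E \<and> (\<forall>B\<in>\<F>. card (S \<inter> B) \<le> c B)}"

definition laminar_matroid :: "'a set \<Rightarrow> 'a set set \<Rightarrow> bool" where
  "laminar_matroid E \<I> \<longleftrightarrow>
     finite E \<and> (\<exists>\<F> c. laminar_family E \<F> \<and> \<I> = laminar_indep E \<F> c)"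

lemma laminar_matroid_imp_matroid:
  assumes "laminar_matroid E \<I>"
  shows "matroid E \<I>"
proof -
  from assms obtain \<F> c where fin: "finite E" and lam: "laminar_family E \<F>"
    and I: "\<I> = laminar_indep E \<F> c"
    unfolding laminar_matroid_def by blast
  have finF: "finite \<F>"
    using lam fin by (meson finite_Pow_iff finite_subset laminar_family_def)
  have down: "T \<in> \<I>" if "S \<in> \<I>" "T \<subseteq> S" for S T
  proof -
    have "finite S" using that I fin by (auto simp: laminar_indep_def intro: finite_subset)
    then have "card (T \<inter> B) \<le> card (S \<inter> B)" for B
      using that by (intro card_mono) auto
    then have "card (T \<inter> B) \<le> c B" if "B \<in> \<F>" for B
      using that \<open>S \<in> \<I>\<close> unfolding I laminar_indep_def
      by (metis (mono_tags, lifting) mem_Collect_eq order_trans)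
    then show ?thesis
      using that unfolding I laminar_indep_def by blast
  qed
  have aug: "\<exists>e\<in>S - T. insert e T \<in> \<I>"
    if S: "S \<in> \<I>" and T: "T \<in> \<I>" and less: "card T < card S" for S T
  proof (rule ccontr)
    assume neg: "\<not> (\<exists>e\<in>S - T. insert e T \<in> \<I>)"
    have finS: "finite S" and finT: "finite T"
      using S T I fin by (auto simp: laminar_indep_def intro: finite_subset)
    define \<T> where "\<T> = {B \<in> \<F>. card (S \<inter> B) \<le> card (T \<inter> B)}"
    define \<X> where "\<X> = {B \<in> \<T>. \<forall>C\<in>\<T>. B \<subseteq> C \<longrightarrow> B = C}"
    have finT': "finite \<T>" using finF by (simp add: \<T>_def)
    then have finX: "finite \<X>" by (simp add: \<X>_def)
    have "\<exists>B\<in>\<T>. e \<in> B" if e: "e \<in> S - T" for e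
    proof -
      have "insert e T \<subseteq> E" using e S T I by (auto simp: laminar_indep_def)
      moreover have "insert e T \<notin> \<I>" using neg e by blast
      ultimately obtain B where B: "B \<in> \<F>" "c B < card (insert e T \<inter> B)"
        unfolding I laminar_indep_def by (auto simp: not_le)
      have TB: "card (T \<inter> B) \<le> c B" and SB: "card (S \<inter> B) \<le> c B"
        using S T B I by (auto simp: laminar_indep_def)
      have eB: "e \<in> B" using B TB by (cases "e \<in> B") auto
      then have "card (insert e T \<inter> B) = Suc (card (T \<inter> B))"
        using e finT by (simp add: Int_insert_left)
      then show ?thesis using B SB eB by (auto simp: \<T>_def)
    qed
    moreover have "\<exists>C\<in>\<X>. B \<subseteq> C" if "B \<in> \<T>" for B
      using finite_has_maximal2[OF finT' that] by (auto simp: \<X>_def)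
    ultimately have cover: "S - T \<subseteq> \<Union>\<X>" by blast
    have disj: "A \<inter> B = {}" if "A \<in> \<X>" "B \<in> \<X>" "A \<noteq> B" for A B
    proof -
      have "A \<in> \<T>" "B \<in> \<T>" and max: "\<not> A \<subseteq> B" "\<not> B \<subseteq> A"
        using that by (auto simp: \<X>_def)
      then have "A \<in> \<F>" "B \<in> \<F>" by (auto simp: \<T>_def)
      with lam max \<open>A \<noteq> B\<close> show ?thesis unfolding laminar_family_def by metis
    qed
    have sum_card: "card (U \<inter> \<Union>\<X>) = (\<Sum>B\<in>\<X>. card (U \<inter> B))" if "finite U" for U
    proof -
      have "U \<inter> \<Union>\<X> = (\<Union>B\<in>\<X>. U \<inter> B)" by blast
      also have "card \<dots> = (\<Sum>B\<in>\<X>. card (U \<inter> B))"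
        by (rule card_UN_disjoint) (use finX that disj in auto)
      finally show ?thesis .
    qed
    have split: "card U = card (U \<inter> \<Union>\<X>) + card (U - \<Union>\<X>)" if "finite U" for U
      using card_Int_Diff[OF that] .
    have "card (S \<inter> \<Union>\<X>) \<le> card (T \<inter> \<Union>\<X>)"
      unfolding sum_card[OF finS] sum_card[OF finT]
      by (rule sum_mono) (auto simp: \<X>_def \<T>_def)
    moreover have "card (S - \<Union>\<X>) \<le> card (T - \<Union>\<X>)"
      by (rule card_mono) (use finT cover in auto)
    ultimately have "card S \<le> card T"
      using split[OF finS] split[OF finT] by linarith
    with less show False by simp
  qed
  have "\<I> \<subseteq> Pow E" "{} \<in> \<I>" by (auto simp: I laminar_indep_def)
  with fin down aug show ?thesis
    unfolding matroid_def by blast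
qed

definition weight_function :: "'a set \<Rightarrow> ('a \<Rightarrow> real) \<Rightarrow> bool" where
  "weight_function E w \<longleftrightarrow> (\<forall>e\<in>E. w e > 0) \<and> inj_on w E"

text \<open>In a matroid with a \<^const>\<open>weight_function\<close> the maximiser is unique, so the
  choice made by \<^const>\<open>arg_max\<close> is immaterial.\<close>

definition max_weight_indep :: "'a set set \<Rightarrow> ('a \<Rightarrow> real) \<Rightarrow> 'a set \<Rightarrow> 'a set" where
  "max_weight_indep \<I> w S = (ARG_MAX (sum w) A. A \<in> \<I> \<and> A \<subseteq> S)"

definition arrived :: "'a set \<Rightarrow> ('a \<Rightarrow> real) \<Rightarrow> real \<Rightarrow> 'a set" where
  "arrived E \<tau> t = {e\<in>E. \<tau> e \<in> {0..t}}"

text \<open>Simultaneous arrivals form a null event; they are ordered arbitrarily.\<close>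

definition arrival_order :: "'a set \<Rightarrow> ('a \<Rightarrow> real) \<Rightarrow> 'a list" where
  "arrival_order E \<tau> = (SOME xs. set xs = E \<and> distinct xs \<and> sorted (map \<tau> xs))"

definition greedy_step ::
  "real \<Rightarrow> 'a set \<Rightarrow> 'a set set \<Rightarrow> ('a \<Rightarrow> real) \<Rightarrow> ('a \<Rightarrow> real) \<Rightarrow> 'a set \<Rightarrow> 'a \<Rightarrow> 'a set" where
  "greedy_step t\<^sub>0 E \<I> w \<tau> ALG e =
     (if \<tau> e > t\<^sub>0 \<and> e \<in> max_weight_indep \<I> w (arrived E \<tau> (\<tau> e)) \<and> insert e ALG \<in> \<I>
      then insert e ALG else ALG)"

definition greedy ::
  "real \<Rightarrow> 'a set \<Rightarrow> 'a set set \<Rightarrow> ('a \<Rightarrow> real) \<Rightarrow> ('a \<Rightarrow> real) \<Rightarrow> 'a set" where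
  "greedy t\<^sub>0 E \<I> w \<tau> = foldl (greedy_step t\<^sub>0 E \<I> w \<tau>) {} (arrival_order E \<tau>)"

definition arrival_measure :: "'a set \<Rightarrow> ('a \<Rightarrow> real) measure" where
  "arrival_measure E = (\<Pi>\<^sub>M e\<in>E. uniform_measure lborel {0..1})"

text \<open>An algorithm maps ground set, independent sets, weights and arrival times to the set of
  selected elements; \<open>\<C>\<close> is the class of matroids on which it is required to perform.\<close>

definition probability_competitive ::
  "('a set \<Rightarrow> 'a set set \<Rightarrow> bool) \<Rightarrow> real \<Rightarrow>
   ('a set \<Rightarrow> 'a set set \<Rightarrow> ('a \<Rightarrow> real) \<Rightarrow> ('a \<Rightarrow> real) \<Rightarrow> 'a set) \<Rightarrow> bool" where
  "probability_competitive \<C> c alg \<longleftrightarrow>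
     (\<forall>E \<I> w. \<C> E \<I> \<longrightarrow> weight_function E w \<longrightarrow>
        (\<forall>e\<in>max_weight_indep \<I> w E.
           \<P>(\<tau> in arrival_measure E. e \<in> alg E \<I> w \<tau>) \<ge> 1 / c))"

end

theory Submission
  imports Defs
begin

text \<open>
  Let \<open>e\<close> be in the optimum and let it arrive at time \<open>s > t\<^sub>0 = 0.7\<close>. It belongs to the running
  optimum, so it can only be rejected because of a full set of the chain of members of the laminar
  family containing \<open>e\<close>; for each capacity \<open>k\<close> occurring in the chain only the largest set
  \<open>D k\<close> of capacity \<open>k\<close> matters. If \<open>D k\<close> is full, then at least \<open>k\<close> of its other
  elements arrived in the window from \<open>t\<^sub>0\<close> to \<open>s\<close> and were in the running optimum on arrival.
  Looking backwards in time, the last of \<open>n\<close> arrived elements is uniformly distributed among them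
  and at most \<open>k\<close> elements of \<open>D k\<close> are in the running optimum, so the number of such arrivals
  is dominated by a Poisson variable of mean \<open>k * l\<close> with \<open>l = ln (s / t\<^sub>0)\<close>.

  By the union bound, \<open>e\<close> is rejected with probability at most the sum over \<open>k \<ge> 1\<close> of the
  probabilities that a Poisson variable of mean \<open>k * l\<close> is at least \<open>k\<close>. The derivative of
  this sum with respect to \<open>l\<close> is a series of tree-function type in \<open>l * exp (- l)\<close> and equals
  \<open>1 / (1 - l)\<^sup>3\<close>, so the sum is \<open>(1 / (1 - l)\<^sup>2 - 1) / 2\<close>. Integrating
  \<open>3 / 2 - 1 / (2 * (1 - l)\<^sup>2)\<close> over \<open>s\<close> from \<open>0.7\<close> to \<open>1\<close> gives slightly more than
  \<open>1 / 4.75\<close>.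
\<close>

subsection \<open>The tree function\<close>

unbundle no vec_syntax
unbundle fps_syntax

text \<open>Up to the factor \<open>m!\<close>, the sum is the coefficient of \<open>x^m\<close> in
  \<open>(exp x - 1)^n\<close>, a power series that starts at \<open>x^n\<close>.\<close>

lemma alternating_binomial_power_sum_eq_0:
  assumes "m < n"
  shows "(\<Sum>k\<le>n. of_nat (n choose k) * (-1) ^ (n - k) * real k ^ m) = 0"
proof -
  have "(fps_exp 1 - 1 :: real fps) ^ n
      = (\<Sum>k\<le>n. of_nat (n choose k) * fps_exp 1 ^ k * (- 1) ^ (n - k))"
    using binomial_ring[of "fps_exp 1 :: real fps" "- 1" n] by simp
  also have "\<dots> = (\<Sum>k\<le>n. fps_const (of_nat (n choose k) * (-1) ^ (n - k)) * fps_exp (of_nat k))"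
    by (intro sum.cong refl)
       (simp add: fps_exp_power_mult fps_of_nat flip: fps_const_mult fps_const_power fps_const_neg)
  finally have "((fps_exp 1 - 1 :: real fps) ^ n) $ m
      = (\<Sum>k\<le>n. of_nat (n choose k) * (-1) ^ (n - k) * real k ^ m / fact m)"
    by (simp add: fps_sum_nth)
  moreover have "((fps_exp 1 - 1 :: real fps) ^ n) $ m = 0"
    using startsby_zero_power_prefix[of "fps_exp 1 - 1 :: real fps" n] assms by simp
  ultimately show ?thesis by (simp flip: sum_divide_distrib)
qed

text \<open>The compositional inverse of \<open>x * exp (- x)\<close>; its coefficients count rooted labelled trees.\<close>

definition tree_fps :: "real fps" where
  "tree_fps = Abs_fps (\<lambda>n. if n = 0 then 0 else real n ^ (n - 1) / fact n)"

text \<open>By \<open>i^(i-1) * i^(n-i) = i^(n-1)\<close>, the \<open>n\<close>-th coefficient of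
  the composition is the alternating binomial sum of the powers \<open>i^(n-1)\<close> divided by
  \<open>n!\<close>, which vanishes for \<open>n \<ge> 2\<close>.\<close>

lemma tree_fps_compose: "tree_fps oo (fps_X * fps_exp (-1)) = fps_X"
proof (rule fps_ext)
  fix n :: nat
  have pw: "((fps_X * fps_exp (-1 :: real)) ^ i) $ n = (- real i) ^ (n - i) / fact (n - i)" if "i \<le> n" for i
    using that by (simp add: power_mult_distrib fps_exp_power_mult fps_X_power_mult_nth)
  show "(tree_fps oo (fps_X * fps_exp (-1))) $ n = fps_X $ n"
  proof (cases "n \<le> 1")
    case True
    then have "n = 0 \<or> n = 1" by auto
    then show ?thesis
      by (auto simp: fps_compose_nth tree_fps_def)
  next
    case False
    have "(tree_fps oo (fps_X * fps_exp (-1))) $ n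
        = (\<Sum>i\<le>n. of_nat (n choose i) * (-1) ^ (n - i) * real i ^ (n - 1) / fact n)"
      unfolding fps_compose_nth atMost_atLeast0
    proof (intro sum.cong refl)
      fix i assume "i \<in> {0..n}"
      then have i: "i \<le> n" by simp
      show "tree_fps $ i * ((fps_X * fps_exp (-1)) ^ i) $ n
        = of_nat (n choose i) * (-1) ^ (n - i) * real i ^ (n - 1) / fact n"
      \<comment> \<open>For \<open>i = 0\<close> the series has coefficient 0 while the binomial
        term carries \<open>0^(n-1)\<close>; these agree only for \<open>n \<ge> 2\<close>, hence
        the separate treatment of small \<open>n\<close>.\<close>
      proof (cases "i = 0")
        case True then show ?thesis using False by (simp add: tree_fps_def)
      next
        case i0: False
        have "(- real i) ^ (n - i) = (-1) ^ (n - i) * real i ^ (n - i)"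
          by (simp flip: power_mult_distrib)
        moreover have "real i ^ (n - 1) = real i ^ (i - 1) * real i ^ (n - i)"
          using i i0 by (simp flip: power_add)
        ultimately show ?thesis
          using i i0 unfolding pw[OF i] by (simp add: tree_fps_def binomial_fact field_simps)
      qed
    qed
    also have "\<dots> = 0"
      using alternating_binomial_power_sum_eq_0[of "n - 1" n] False
      by (simp flip: sum_divide_distrib)
    finally show ?thesis using False by simp
  qed
qed

text \<open>Composition with \<open>x * exp (-x)\<close> is injective and turns
  \<open>tree_fps\<close> into \<open>x\<close>. The chain rule applied to
  \<open>tree_fps_compose\<close> shows that the composed derivative is the inverse of
  \<open>exp (-x) * (1 - x)\<close>, and the equation becomes an identity.\<close>

lemma tree_fps_ode: "fps_X * fps_deriv tree_fps * (1 - tree_fps) = tree_fps"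
proof -
  let ?U = "fps_X * fps_exp (-1 :: real)"
  have "fps_deriv (tree_fps oo ?U) = (fps_deriv tree_fps oo ?U) * fps_deriv ?U"
    by (rule fps_compose_deriv) simp
  then have d: "(fps_deriv tree_fps oo ?U) * (fps_exp (-1) * (1 - fps_X)) = 1"
    by (simp add: tree_fps_compose algebra_simps flip: fps_const_neg)
  have "(fps_X * fps_deriv tree_fps * (1 - tree_fps)) oo ?U
      = ?U * (fps_deriv tree_fps oo ?U) * (1 - fps_X)"
    by (simp add: fps_compose_mult_distrib fps_compose_sub_distrib tree_fps_compose)
  also have "\<dots> = fps_X * ((fps_deriv tree_fps oo ?U) * (fps_exp (-1) * (1 - fps_X)))"
    by (simp only: mult_ac)
  also have "\<dots> = tree_fps oo ?U"
    unfolding d by (simp add: tree_fps_compose)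
  finally show ?thesis
    by (subst (asm) fps_compose_inj_right) auto
qed

text \<open>The series obtained from \<open>tree_fps\<close> by applying the operator
  \<open>x d/dx\<close> twice. It is what the derivative of the sum of Poisson tails becomes after
  multiplication by \<open>l\<close>, at the argument \<open>l * exp (- l)\<close>.\<close>

definition tree_fps2 :: "real fps" where
  "tree_fps2 = Abs_fps (\<lambda>n. real n ^ (n + 1) / fact n)"

lemma tree_fps2_altdef: "tree_fps2 = fps_X * fps_deriv (fps_X * fps_deriv tree_fps)"
proof (rule fps_ext)
  fix n show "tree_fps2 $ n = (fps_X * fps_deriv (fps_X * fps_deriv tree_fps)) $ n"
    by (cases n) (simp_all add: tree_fps2_def tree_fps_def power_Suc field_simps del: fact_Suc)
qed

text \<open>With \<open>G = x T'\<close> and \<open>u = 1 - T\<close>, the differential equation is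
  \<open>G * u = T\<close>. Applying \<open>x d/dx\<close> gives
  \<open>tree_fps2 * u = G * (1 + G)\<close>, and after multiplication by \<open>u^2\<close> the
  right side is \<open>(G * u) * (u + G * u) = T\<close>.\<close>

lemma tree_fps2_eq: "tree_fps2 * (1 - tree_fps) ^ 3 = tree_fps"
proof -
  define G where "G = fps_X * fps_deriv tree_fps"
  define u where "u = 1 - tree_fps"
  have G: "G * u = tree_fps"
    using tree_fps_ode by (simp add: G_def u_def)
  have H: "tree_fps2 = fps_X * fps_deriv G" by (simp add: tree_fps2_altdef G_def)
  have du: "fps_X * fps_deriv u = - G" by (simp add: G_def u_def)
  have "fps_X * fps_deriv (G * u) = G" unfolding G by (simp add: G_def)
  then have "tree_fps2 * u + G * (fps_X * fps_deriv u) = G"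
    unfolding H by (simp add: algebra_simps)
  then have "tree_fps2 * u = G * (1 + G)"
    unfolding du by (simp add: algebra_simps)
  then have "tree_fps2 * u ^ 3 = G * (1 + G) * u ^ 2"
    by (simp add: power3_eq_cube power2_eq_square flip: mult.assoc)
  also have "\<dots> = (G * u) * (u + G * u)"
    by (simp only: power2_eq_square) (simp add: algebra_simps)
  also have "\<dots> = tree_fps" unfolding G by (simp add: u_def)
  finally show ?thesis by (simp add: u_def)
qed

section \<open>Convergence of the tree series and its values at real arguments\<close>

lemma fps_conv_radius_tree_fps: "fps_conv_radius tree_fps \<ge> ereal (exp (-1))"
  unfolding fps_conv_radius_def
proof (rule conv_radius_geI_ex)
  fix r :: real assume r: "0 < r" "ereal r < ereal (exp (-1))"
  have "summable (\<lambda>n. tree_fps $ n * r ^ n)"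
  proof (rule summable_comparison_test')
    have "r * exp 1 < 1" using r by (simp add: exp_minus field_simps)
    then show "summable (\<lambda>n. (r * exp 1) ^ n)"
      using r by (intro summable_geometric) simp
    fix n :: nat assume "0 \<le> n"
    \<comment> \<open>\<open>n^n / n!\<close> is a single term of the exponential series at
      \<open>n\<close>, so the coefficients grow at most like \<open>exp 1 ^ n\<close>.\<close>
    have "real n ^ (n - 1) / fact n \<le> exp (real n)" if "n > 0"
    proof -
      have "real n ^ (n - 1) / fact n \<le> real n ^ n / fact n"
        using that by (intro divide_right_mono power_increasing) auto
      also have "\<dots> \<le> (\<Sum>k\<le>n. real n ^ k / fact k)"
        by (rule member_le_sum) auto
      also have "\<dots> \<le> exp (real n)"
        using sum_le_suminf[of "\<lambda>k. real n ^ k / fact k" "{..n}"] exp_converges[of "real n"]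
        by (simp add: sums_iff divide_inverse mult.commute)
      finally show ?thesis .
    qed
    then have "tree_fps $ n \<le> exp (real n)" by (simp add: tree_fps_def)
    then have "tree_fps $ n * r ^ n \<le> exp 1 ^ n * r ^ n"
      using r by (intro mult_right_mono) (simp_all add: exp_of_nat_mult[symmetric])
    then show "norm (tree_fps $ n * r ^ n) \<le> (r * exp 1) ^ n"
      using r by (simp add: tree_fps_def power_mult_distrib mult.commute)
  qed
  then show "\<exists>z. norm z = r \<and> summable (\<lambda>n. tree_fps $ n * z ^ n)"
    using r by (intro exI[of _ r]) simp
qed

lemma less_fps_conv_radius_tree_fps:
  assumes "\<bar>x :: real\<bar> < exp (-1)"
  shows "ereal (norm x) < fps_conv_radius tree_fps"
    and "ereal (norm x) < fps_conv_radius (1 - tree_fps)"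
    and "ereal (norm x) < fps_conv_radius (fps_shift 1 tree_fps)"
    and "ereal (norm x) < fps_conv_radius (fps_deriv tree_fps)"
    and "ereal (norm x) < fps_conv_radius tree_fps2"
proof -
  have *: "ereal (norm x) < ereal (exp (-1))" using assms by simp
  show 1: "ereal (norm x) < fps_conv_radius tree_fps"
    using * fps_conv_radius_tree_fps by (rule less_le_trans)
  then show "ereal (norm x) < fps_conv_radius (fps_shift 1 tree_fps)" by simp
  show "ereal (norm x) < fps_conv_radius (1 - tree_fps)"
    using fps_conv_radius_diff[of 1 tree_fps] 1 by (auto intro: less_le_trans)
  show 2: "ereal (norm x) < fps_conv_radius (fps_deriv tree_fps)"
    using fps_conv_radius_deriv[of tree_fps] 1 by (auto intro: less_le_trans)
  have 3: "ereal (norm x) < fps_conv_radius (fps_X * fps_deriv tree_fps)"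
    using fps_conv_radius_mult[of fps_X "fps_deriv tree_fps"] 2 by (auto intro: less_le_trans)
  have 4: "ereal (norm x) < fps_conv_radius (fps_deriv (fps_X * fps_deriv tree_fps))"
    using fps_conv_radius_deriv[of "fps_X * fps_deriv tree_fps"] 3 by (rule less_le_trans[rotated])
  show "ereal (norm x) < fps_conv_radius tree_fps2"
    unfolding tree_fps2_altdef
    using fps_conv_radius_mult[of fps_X "fps_deriv (fps_X * fps_deriv tree_fps)"] 4
    by (auto intro: less_le_trans)
qed

text \<open>With \<open>S = T / x\<close>, this is the logarithmic derivative
  \<open>S' / S = T'\<close> of \<open>S = exp T\<close>. It follows from the differential equation
  by cancelling \<open>x\<close>, and makes \<open>S * exp (- T)\<close> constant.\<close>

lemma fps_deriv_shift_tree_fps: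
  "fps_deriv (fps_shift 1 tree_fps) = fps_shift 1 tree_fps * fps_deriv tree_fps"
proof -
  define S where "S = fps_shift 1 tree_fps"
  have T: "tree_fps = fps_X * S"
    by (rule fps_ext) (auto simp: S_def tree_fps_def)
  have "fps_X * (fps_deriv tree_fps * (1 - tree_fps)) = fps_X * S"
    using tree_fps_ode T by (simp add: mult.assoc)
  then have "fps_deriv tree_fps * (1 - tree_fps) = S" by simp
  moreover have "fps_deriv tree_fps = S + fps_X * fps_deriv S"
    unfolding T by simp
  ultimately have "fps_X * fps_deriv S = fps_X * (S * fps_deriv tree_fps)"
    by (metis (no_types, lifting) T add_diff_cancel_left' add_diff_eq diff_add_cancel
        mult.assoc mult.commute mult.right_neutral right_diff_distrib)
  then show ?thesis by (simp add: S_def)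
qed

text \<open>The derivative of \<open>S * exp (- T)\<close> vanishes for arguments below
  \<open>exp (-1)\<close> in absolute value, so the product keeps its value 1 at 0;
  \<open>T = x * S\<close> then gives the claim.\<close>

lemma eval_tree_fps_exp:
  assumes "\<bar>x\<bar> < exp (-1)"
  shows "eval_fps tree_fps x * exp (- eval_fps tree_fps x) = x"
proof -
  let ?T = "eval_fps tree_fps" and ?S = "eval_fps (fps_shift 1 tree_fps)"
  have *: "((\<lambda>x. ?S x * exp (- ?T x)) has_field_derivative 0) (at y)"
    if "y \<in> {-exp (-1)<..<exp (-1)}" for y
  proof -
    have y: "\<bar>y\<bar> < exp (-1)" using that by auto
    note c = less_fps_conv_radius_tree_fps[OF y]
    have "((\<lambda>x. ?S x * exp (- ?T x)) has_field_derivative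
        (eval_fps (fps_deriv (fps_shift 1 tree_fps)) y * exp (- ?T y)
          + ?S y * (exp (- ?T y) * - eval_fps (fps_deriv tree_fps) y))) (at y)"
      using c by (auto intro!: derivative_eq_intros has_field_derivative_eval_fps)
    also have "eval_fps (fps_deriv (fps_shift 1 tree_fps)) y
        = ?S y * eval_fps (fps_deriv tree_fps) y"
      unfolding fps_deriv_shift_tree_fps using c by (intro eval_fps_mult)
    finally show ?thesis by (simp add: algebra_simps)
  qed
  have "-exp (-1) < (exp (-1) :: real)" by (smt (verit) exp_gt_zero)
  then have "?S x * exp (- ?T x) = ?S 0 * exp (- ?T 0)"
    by (rule DERIV_isconst3[OF _ _ _ *]) (use assms in auto)
  also have "\<dots> = 1" by (simp add: eval_fps_at_0 tree_fps_def)
  finally have 1: "?S x * exp (- ?T x) = 1" .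
  have "tree_fps = fps_X * fps_shift 1 tree_fps"
    by (rule fps_ext) (auto simp: tree_fps_def)
  then have "?T x = eval_fps (fps_X * fps_shift 1 tree_fps) x" by simp
  also have "\<dots> = x * ?S x"
    using less_fps_conv_radius_tree_fps[OF assms] by (simp add: eval_fps_mult)
  finally show ?thesis using 1 by simp
qed

lemma mult_exp_minus_strict_mono:
  fixes a b :: real
  assumes "a < b" "b \<le> 1"
  shows "a * exp (- a) < b * exp (- b)"
proof (rule DERIV_pos_imp_increasing_open[OF assms(1)])
  fix x assume "a < x" "x < b"
  then show "\<exists>y. ((\<lambda>x. x * exp (- x)) has_real_derivative y) (at x) \<and> y > 0"
    using assms by (intro exI[of _ "(1 - x) * exp (-x)"] conjI)
      (auto intro!: derivative_eq_intros simp: algebra_simps)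
qed (auto intro!: continuous_intros)

text \<open>Both \<open>l\<close> and the value of the series solve
  \<open>y * exp (- y) = x\<close>, and the left side is strictly increasing up to 1, so only a
  solution above 1 has to be excluded.\<close>

lemma eval_tree_fps:
  assumes "0 \<le> l" "l < 1"
  shows "eval_fps tree_fps (l * exp (- l)) = l"
proof -
  let ?T = "eval_fps tree_fps"
  define x where "x = l * exp (- l)"
  have x: "0 \<le> x" "x < exp (-1)"
    using assms mult_exp_minus_strict_mono[of l 1] by (auto simp: x_def)
  \<comment> \<open>The series is continuous and 0 at 0; reaching 1 would mean taking the value 1 at
    some \<open>y \<le> x\<close>, and then \<open>y = exp (-1)\<close>, which lies beyond
    \<open>x\<close>.\<close>
  have "?T x < 1"
  proof (rule ccontr)
    assume "\<not> ?T x < 1"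
    moreover have "?T 0 = 0" by (simp add: eval_fps_at_0 tree_fps_def)
    moreover have "continuous_on {0..x} ?T"
    proof (rule continuous_on_subset[OF continuous_on_eval_fps], rule subsetI)
      fix y assume "y \<in> {0..x}"
      then show "y \<in> eball 0 (fps_conv_radius tree_fps)"
        using less_fps_conv_radius_tree_fps(1)[of y] x by simp
    qed
    ultimately obtain y where y: "0 \<le> y" "y \<le> x" "?T y = 1"
      using IVT'[of ?T 0 1 x] x by auto
    then show False using eval_tree_fps_exp[of y] x by simp
  qed
  moreover have "?T x * exp (- ?T x) = l * exp (- l)"
    using eval_tree_fps_exp[of x] x by (simp add: x_def)
  ultimately show ?thesis
    using mult_exp_minus_strict_mono[of "?T x" l] mult_exp_minus_strict_mono[of l "?T x"] assms
    by (fold x_def) (cases "?T x" l rule: linorder_cases; simp)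
qed

lemma eval_tree_fps2:
  assumes "0 \<le> l" "l < 1"
  shows "eval_fps tree_fps2 (l * exp (- l)) = l / (1 - l) ^ 3"
proof -
  define x where "x = l * exp (- l)"
  have x: "\<bar>x\<bar> < exp (-1)"
    using assms mult_exp_minus_strict_mono[of l 1] by (auto simp: x_def)
  note c = less_fps_conv_radius_tree_fps[OF x]
  have "ereal (norm x) < fps_conv_radius ((1 - tree_fps) ^ 3)"
    using c(2) fps_conv_radius_power by (rule less_le_trans)
  then have "eval_fps (tree_fps2 * (1 - tree_fps) ^ 3) x
      = eval_fps tree_fps2 x * (1 - eval_fps tree_fps x) ^ 3"
    using c by (simp add: eval_fps_mult eval_fps_power eval_fps_diff)
  then have "eval_fps tree_fps2 x * (1 - l) ^ 3 = l"
    unfolding tree_fps2_eq using eval_tree_fps[OF assms] by (simp add: x_def)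
  then show ?thesis using assms by (simp add: x_def field_simps)
qed

lemma sum_tree_terms_le:
  assumes "finite K" "0 \<le> l" "l < 1"
  shows "(\<Sum>k\<in>K. real k ^ (k + 1) / fact k * (l * exp (- l)) ^ k) \<le> l / (1 - l) ^ 3"
proof -
  have x: "\<bar>l * exp (- l)\<bar> < exp (-1)"
    using assms mult_exp_minus_strict_mono[of l 1] by auto
  have s: "(\<lambda>k. real k ^ (k + 1) / fact k * (l * exp (- l)) ^ k) sums (l / (1 - l) ^ 3)"
    using sums_eval_fps[OF less_fps_conv_radius_tree_fps(5)[OF x]]
    unfolding eval_tree_fps2[OF assms(2,3)] by (simp add: tree_fps2_def)
  show ?thesis
    using sum_le_suminf[OF sums_summable[OF s] assms(1)] assms(2) sums_unique[OF s] by simp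
qed

subsection \<open>Poisson tails\<close>

text \<open>The probability that a Poisson variable of mean \<open>m\<close> is at least
  \<open>k\<close>, given as an elementary function so that it can be differentiated in
  \<open>m\<close>.\<close>

definition poisson_tail :: "nat \<Rightarrow> real \<Rightarrow> real" where
  "poisson_tail k m = 1 - (\<Sum>j<k. exp (- m) * m ^ j / fact j)"

lemma poisson_tail_0 [simp]: "poisson_tail 0 m = 1"
  by (simp add: poisson_tail_def)

lemma poisson_tail_Suc: "poisson_tail (Suc k) m = poisson_tail k m - exp (- m) * m ^ k / fact k"
  by (simp add: poisson_tail_def)

lemma poisson_tail_Suc_at_0 [simp]: "poisson_tail (Suc k) 0 = 0"
  by (induction k) (simp_all add: poisson_tail_Suc)

lemma poisson_tail_nonneg:
  assumes "0 \<le> m" shows "0 \<le> poisson_tail k m"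
proof -
  have "(\<Sum>j<k. m ^ j / fact j) \<le> exp m"
    using sum_le_suminf[of "\<lambda>j. m ^ j / fact j" "{..<k}"] exp_converges[of m] assms
    by (simp add: sums_iff divide_inverse mult.commute)
  then have "exp (- m) * (\<Sum>j<k. m ^ j / fact j) \<le> exp (- m) * exp m"
    by (intro mult_left_mono) auto
  then show ?thesis
    by (simp add: poisson_tail_def sum_distrib_left exp_minus)
qed

lemma has_real_derivative_poisson_tail_Suc:
  "(poisson_tail (Suc k) has_real_derivative exp (- m) * m ^ k / fact k) (at m within A)"
proof (induction k)
  case 0
  show ?case by (auto simp: poisson_tail_def intro!: derivative_eq_intros)
next
  case (Suc k)
  have "((\<lambda>m. poisson_tail (Suc k) m - exp (- m) * m ^ Suc k / fact (Suc k)) has_real_derivative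
      exp (- m) * m ^ k / fact k -
      (- exp (- m) * m ^ Suc k + exp (- m) * (real (Suc k) * m ^ k)) / fact (Suc k)) (at m within A)"
    by (rule derivative_eq_intros Suc refl | simp)+
  also have "exp (- m) * m ^ k / fact k -
      (- exp (- m) * m ^ Suc k + exp (- m) * (real (Suc k) * m ^ k)) / fact (Suc k)
    = exp (- m) * m ^ Suc k / fact (Suc k)"
  proof -
    have "exp (- m) * (real (Suc k) * m ^ k) / fact (Suc k) = exp (- m) * m ^ k / fact k"
      by (simp add: fact_Suc del: of_nat_Suc)
    then show ?thesis by (simp only: add_divide_distrib)
  qed
  finally show ?case
    by (simp only: poisson_tail_Suc[of "Suc k", abs_def])
qed

text \<open>The difference \<open>f\<close> of the two sides is 0 at \<open>l = 0\<close>, because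
  every tail with \<open>k \<ge> 1\<close> vanishes there, and its derivative is nonnegative by
  \<open>sum_tree_terms_le\<close>.\<close>

lemma sum_poisson_tail_le:
  assumes K: "finite K" "0 \<notin> K" and l: "0 \<le> l" "l < 1"
  shows "(\<Sum>k\<in>K. poisson_tail k (real k * l)) \<le> (1 / (1 - l) ^ 2 - 1) / 2"
proof -
  define f where "f l = (1 / (1 - l) ^ 2 - 1) / 2 - (\<Sum>k\<in>K. poisson_tail k (real k * l))" for l :: real
  have der: "(f has_real_derivative
      (1 / (1 - y) ^ 3 - (\<Sum>k\<in>K. real k * (exp (- (real k * y)) * (real k * y) ^ (k - 1) / fact (k - 1))))) (at y)"
    if y: "0 \<le> y" "y < 1" for y
  proof -
    have 1: "((\<lambda>l. (1 / (1 - l) ^ 2 - 1) / 2) has_real_derivative 1 / (1 - y) ^ 3) (at y)"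
      using y by (auto intro!: derivative_eq_intros; simp add: divide_simps)
        (simp add: power2_eq_square power3_eq_cube power4_eq_xxxx algebra_simps)
    have 2: "((\<lambda>l. poisson_tail k (real k * l)) has_real_derivative
      real k * (exp (- (real k * y)) * (real k * y) ^ (k - 1) / fact (k - 1))) (at y)" if "k \<in> K" for k
    proof -
      obtain j where j: "k = Suc j" using \<open>k \<in> K\<close> K by (metis not0_implies_Suc)
      have "(poisson_tail (Suc j) \<circ> (\<lambda>l. real k * l) has_real_derivative
          (exp (- (real k * y)) * (real k * y) ^ j / fact j) * real k) (at y)"
        by (intro DERIV_chain has_real_derivative_poisson_tail_Suc)
           (auto intro!: derivative_eq_intros)
      then show ?thesis by (simp add: j o_def mult.commute)
    qed
    show ?thesis
      unfolding f_def by (intro DERIV_diff 1 DERIV_sum 2)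
  qed
  have "f 0 \<le> f l"
  proof (rule DERIV_nonneg_imp_increasing_open[OF l(1)])
    fix y assume y: "0 < y" "y < l"
    \<comment> \<open>Multiplied by \<open>y > 0\<close>, the derivative of each tail becomes a term
      of \<open>tree_fps2\<close> at \<open>y * exp (- y)\<close>.\<close>
    have eq: "y * (real k * (exp (- (real k * y)) * (real k * y) ^ (k - 1) / fact (k - 1)))
      = real k ^ (k + 1) / fact k * (y * exp (- y)) ^ k" if "k \<in> K" for k
    proof -
      obtain j where j: "k = Suc j" using \<open>k \<in> K\<close> K by (metis not0_implies_Suc)
      have e: "exp (- (real k * y)) = exp (- y) ^ k"
        by (simp flip: exp_of_nat_mult)
      have p: "y * (c * (c * y) ^ j) = c ^ Suc j * y ^ Suc j" for c :: real
        by (simp add: power_mult_distrib)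
      have "y * (real k * (exp (- (real k * y)) * (real k * y) ^ (k - 1) / fact (k - 1)))
          = y * (real k * (real k * y) ^ j) * exp (- y) ^ k / fact j"
        unfolding e by (simp add: j)
      also have "\<dots> = real k ^ k * (y * exp (- y)) ^ k / fact j"
        unfolding p by (simp only: j power_mult_distrib mult_ac)
      also have "1 / fact j = real k / fact k"
        unfolding j by (simp only: fact_Suc) simp
      then have "real k ^ k * (y * exp (- y)) ^ k / fact j
          = real k ^ (k + 1) / fact k * (y * exp (- y)) ^ k"
        using zero_less_Suc[of j, folded j] by (simp add: field_simps)
      finally show ?thesis .
    qed
    have "y * (\<Sum>k\<in>K. real k * (exp (- (real k * y)) * (real k * y) ^ (k - 1) / fact (k - 1)))
        = (\<Sum>k\<in>K. real k ^ (k + 1) / fact k * (y * exp (- y)) ^ k)"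
      unfolding sum_distrib_left by (intro sum.cong refl eq)
    also have "\<dots> \<le> y * (1 / (1 - y) ^ 3)"
      using sum_tree_terms_le[OF K(1), of y] y l by simp
    finally have "(\<Sum>k\<in>K. real k * (exp (- (real k * y)) * (real k * y) ^ (k - 1) / fact (k - 1)))
        \<le> 1 / (1 - y) ^ 3"
      using y by (simp only: mult_le_cancel_left_pos)
    then show "\<exists>d. (f has_real_derivative d) (at y) \<and> 0 \<le> d"
      using der[of y] y l by (intro exI conjI) auto
  next
    show "continuous_on {0..l} f"
    proof (intro continuous_at_imp_continuous_on ballI)
      fix y assume "y \<in> {0..l}"
      with l show "isCont f y" by (intro DERIV_isCont[OF der]) auto
    qed
  qed
  moreover have "poisson_tail k 0 = 0" if "k \<in> K" for k
    using that K by (cases k) auto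
  ultimately show ?thesis by (simp add: f_def)
qed

text \<open>This form mirrors the recursion on the last arrival, where a counted arrival replaces
  \<open>k\<close> by \<open>k - 1\<close>. For \<open>k = 0\<close> truncated subtraction gives the
  derivative 0 of a constant.\<close>

lemma has_real_derivative_poisson_tail:
  "(poisson_tail k has_real_derivative poisson_tail (k - 1) m - poisson_tail k m) (at m within A)"
proof (cases k)
  case 0
  then have "poisson_tail k = (\<lambda>_. 1)" by auto
  then show ?thesis using 0 by simp
next
  case (Suc j)
  then show ?thesis
    using has_real_derivative_poisson_tail_Suc[of j m A] by (simp add: poisson_tail_Suc)
qed

lemma continuous_on_poisson_tail [continuous_intros]:
  assumes "continuous_on A f"
  shows "continuous_on A (\<lambda>x. poisson_tail k (f x))"
proof -
  have "continuous_on UNIV (poisson_tail k)"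
    using has_real_derivative_poisson_tail
    by (intro continuous_at_imp_continuous_on ballI) (blast intro: DERIV_isCont)
  from continuous_on_compose2[OF this assms] show ?thesis by simp
qed

lemma poisson_tail_pred_ge:
  assumes "0 \<le> m" shows "poisson_tail k m \<le> poisson_tail (k - 1) m"
  using assms by (cases k) (simp_all add: poisson_tail_Suc)

subsection \<open>Numerical bound for the success probability\<close>

text \<open>The inner sums are the coefficients of \<open>exp l / (1 - l)\<close>. Multiplication by
  \<open>1 - l\<close> telescopes to the truncated exponential series minus a nonnegative
  remainder.\<close>

lemma sum_exp_partial_sums_le:
  fixes l :: real
  assumes "0 \<le> l"
  shows "(1 - l) * (\<Sum>n\<le>N. (\<Sum>j\<le>n. 1 / fact j) * l ^ n) \<le> exp l"
proof -
  have "(1 - l) * (\<Sum>n\<le>N. (\<Sum>j\<le>n. 1 / fact j) * l ^ n)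
      = (\<Sum>n\<le>N. l ^ n / fact n) - (\<Sum>j\<le>N. 1 / fact j) * l ^ (N + 1)"
  proof (induction N)
    case (Suc N)
    define e :: real where "e = (\<Sum>j\<le>N. 1 / fact j)"
    define f :: real where "f = 1 / fact (Suc N)"
    have "(1 - l) * (\<Sum>n\<le>Suc N. (\<Sum>j\<le>n. 1 / fact j) * l ^ n)
        = (1 - l) * (\<Sum>n\<le>N. (\<Sum>j\<le>n. 1 / fact j) * l ^ n) + (1 - l) * ((e + f) * l ^ Suc N)"
      by (simp add: distrib_left e_def f_def del: fact_Suc)
    also have "\<dots> = (\<Sum>n\<le>N. l ^ n / fact n) + f * l ^ Suc N - (e + f) * l ^ (Suc N + 1)"
      unfolding Suc by (simp add: algebra_simps flip: e_def)
    finally show ?case by (simp add: e_def f_def del: fact_Suc)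
  qed simp
  also have "\<dots> \<le> (\<Sum>n\<le>N. l ^ n / fact n)"
    using assms by (simp add: sum_nonneg)
  also have "\<dots> \<le> exp l"
    using sum_le_suminf[of "\<lambda>j. l ^ j / fact j" "{..N}"] exp_converges[of l] assms
    by (simp add: sums_iff divide_inverse mult.commute)
  finally show ?thesis .
qed

lemma ln_10_over_7_bounds: "ln (10 / 7 :: real) \<in> {0.3566..0.3567}"
  using ln_approx_bounds[of "10 / 7" 2] by (simp add: eval_nat_numeral)

lemma ln_over_threshold_bounds:
  fixes s :: real
  assumes "s \<in> {0.7..1}"
  shows "0 \<le> ln (s / 0.7)" "ln (s / 0.7) \<le> 0.3567"
proof -
  show "0 \<le> ln (s / 0.7)" using assms by simp
  have "ln (s / 0.7) \<le> ln (10 / 7)" using assms by (subst ln_le_cancel_iff) auto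
  with ln_10_over_7_bounds show "ln (s / 0.7) \<le> 0.3567" by simp
qed

text \<open>The integrand is 1 minus the bound of \<open>sum_poisson_tail_le\<close> at
  \<open>l = ln (s / 0.7)\<close>. Its integral involves the exponential integral, so it is bounded
  below by \<open>\<phi>\<close>, which has the explicit antiderivative
  \<open>\<Phi>\<close>.\<close>

lemma integral_success_probability_ge:
  obtains I where "((\<lambda>s. 3 / 2 - 1 / (2 * (1 - ln (s / 0.7)) ^ 2)) has_integral I) {0.7..1 :: real}"
    and "1 / 4.75 \<le> I"
proof -
  \<comment> \<open>Degree 6 is accurate enough for the numerical comparison at the end of the
    proof.\<close>
  define p where "p l = (\<Sum>n\<le>6. (\<Sum>j\<le>n. 1 / fact j) * l ^ n)" for l :: real
  define P where "P l = (\<Sum>n\<le>6. (\<Sum>j\<le>n. 1 / fact j) * l ^ (n + 1) / real (n + 1))" for l :: real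
  have dP: "(P has_real_derivative p l) (at l within A)" for l A
  proof -
    have "((\<lambda>l. a * l ^ (n + 1) / real (n + 1)) has_real_derivative a * l ^ n) (at l within A)" for a n
      using DERIV_cdivide[OF DERIV_cmult[OF DERIV_power[OF DERIV_ident]], of a "n + 1" "real (n + 1)" l A]
      by (simp del: of_nat_Suc)
    then show ?thesis
      unfolding P_def p_def by (intro DERIV_sum) blast
  qed
  \<comment> \<open>With \<open>l = ln (s / 0.7)\<close>, \<open>s / (1 - l)\<close> has derivative \<open>1 / (1 - l) + 1 / (1 - l)\<^sup>2\<close>, and
    \<open>1 / (1 - l)\<close> is \<open>0.7 / s\<close> times a power series with nonnegative coefficients, truncated in \<open>p\<close>.\<close>
  define \<Phi> where "\<Phi> s = 3 / 2 * s - (s / (1 - ln (s / 0.7)) - 0.7 * P (ln (s / 0.7))) / 2" for s :: real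
  define \<phi> where "\<phi> s = 3 / 2 - (1 / (1 - ln (s / 0.7)) + 1 / (1 - ln (s / 0.7)) ^ 2
    - 0.7 / s * p (ln (s / 0.7))) / 2" for s :: real
  have d\<Phi>: "(\<Phi> has_real_derivative \<phi> s) (at s within {0.7..1})" if s: "s \<in> {0.7..1}" for s
  proof -
    have dl: "((\<lambda>s. ln (s / 0.7)) has_real_derivative 1 / s) (at s within {0.7..1})"
      using s by (auto intro!: derivative_eq_intros)
    have 1: "((\<lambda>s. P (ln (s / 0.7))) has_real_derivative p (ln (s / 0.7)) * (1 / s)) (at s within {0.7..1})"
      using DERIV_chain[OF dP dl] by (simp add: o_def)
    have "1 - ln (s / 0.7) \<noteq> 0" using ln_over_threshold_bounds[OF s] by simp
    then have 2: "((\<lambda>s. s / (1 - ln (s / 0.7))) has_real_derivative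
       (1 / (1 - ln (s / 0.7)) + 1 / (1 - ln (s / 0.7)) ^ 2)) (at s within {0.7..1})"
      using s by (auto intro!: derivative_eq_intros dl simp: power2_eq_square divide_simps)
    show ?thesis
      unfolding \<Phi>_def \<phi>_def by (rule derivative_eq_intros 1 2 refl | simp)+
  qed
  have i\<phi>: "(\<phi> has_integral (\<Phi> 1 - \<Phi> 0.7)) {0.7..1}"
    using d\<Phi> by (intro fundamental_theorem_of_calculus)
      (auto simp: has_real_derivative_iff_has_vector_derivative)
  have "continuous_on {0.7..1} (\<lambda>s. 3 / 2 - 1 / (2 * (1 - ln (s / 0.7)) ^ 2) :: real)"
    using ln_over_threshold_bounds by (intro continuous_intros) force+
  then obtain I where I: "((\<lambda>s. 3 / 2 - 1 / (2 * (1 - ln (s / 0.7)) ^ 2)) has_integral I) {0.7..1 :: real}"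
    using integrable_continuous_interval by blast
  have "\<Phi> 1 - \<Phi> 0.7 \<le> I"
  proof (rule has_integral_le[OF i\<phi> I])
    fix s :: real assume s: "s \<in> {0.7..1}"
    define l where "l = ln (s / 0.7)"
    have l: "0 \<le> l" "l < 1" using ln_over_threshold_bounds[OF s] by (auto simp: l_def)
    have "exp l = s / 0.7" using s by (simp add: l_def)
    with sum_exp_partial_sums_le[OF l(1), of 6] have "(1 - l) * p l \<le> s / 0.7"
      by (simp add: p_def)
    then have "0.7 / s * p l \<le> 1 / (1 - l)"
      using l s by (simp add: field_simps)
    then show "\<phi> s \<le> 3 / 2 - 1 / (2 * (1 - ln (s / 0.7)) ^ 2)"
      unfolding \<phi>_def l_def[symmetric] by simp
  qed
  moreover have "1 / 4.75 \<le> \<Phi> 1 - \<Phi> 0.7"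
  proof -
    define l :: real where "l = ln (10 / 7)"
    have l: "0.3566 \<le> l" "l \<le> 0.3567" using ln_10_over_7_bounds by (auto simp: l_def)
    \<comment> \<open>Each end of the enclosure of \<open>l\<close> is used where it lowers the
      value: \<open>P\<close> and \<open>1 / (1 - l)\<close> both increase, but enter with opposite
      signs.\<close>
    have "P 0.3566 \<le> P l"
      unfolding P_def using l by (intro sum_mono divide_right_mono mult_left_mono power_mono sum_nonneg) auto
    moreover have "1 / (1 - l) \<le> 1 / (1 - 0.3567)"
      using l by (intro divide_left_mono) auto
    moreover have "\<Phi> 1 - \<Phi> 0.7 = 0.8 - (1 / (1 - l) - 0.7 * P l) / 2"
      by (simp add: \<Phi>_def l_def P_def)
    moreover have "1 / 4.75 \<le> 0.8 - (1 / (1 - 0.3567) - 0.7 * P 0.3566) / 2"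
      by (simp add: P_def eval_nat_numeral)
    moreover have "b \<le> x" if "q \<le> q'" "r' \<le> r" "x = 0.8 - (r' - 0.7 * q') / 2" "b \<le> 0.8 - (r - 0.7 * q) / 2"
      for b x q q' r r' :: real
      using that by (simp add: field_simps)
    ultimately show ?thesis by blast
  qed
  ultimately show ?thesis using I that by (meson order_trans)
qed

subsection \<open>Maximum-weight independent sets\<close>

lemma matroid_extend:
  assumes M: "matroid E \<I>" and S: "S \<in> \<I>" and T: "T \<in> \<I>"
  obtains J where "J \<in> \<I>" "T \<subseteq> J" "J \<subseteq> S \<union> T" "card S \<le> card J"
proof -
  have fin: "finite A" if "A \<in> \<I>" for A
    using M that by (auto simp: matroid_def intro: finite_subset)
  have "\<exists>J\<in>\<I>. T \<subseteq> J \<and> J \<subseteq> S \<union> T \<and> card S \<le> card J"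
    using T
  proof (induction "card S - card T" arbitrary: T)
    case 0
    then show ?case by (intro bexI[of _ T]) auto
  next
    case (Suc n)
    then have "card T < card S" by simp
    then obtain e where e: "e \<in> S - T" "insert e T \<in> \<I>"
      using M S Suc.prems unfolding matroid_def by blast
    have c: "card (insert e T) = Suc (card T)"
      using e fin[OF Suc.prems] by simp
    have "n = card S - card (insert e T)" using Suc.hyps(2) c by simp
    from Suc.hyps(1)[OF this e(2)]
    obtain J where "J \<in> \<I>" "insert e T \<subseteq> J" "J \<subseteq> S \<union> insert e T" "card S \<le> card J"
      by blast
    then show ?case
      using e by (intro bexI[of _ J]) auto
  qed
  then show ?thesis using that by blast
qed

lemma max_weight_indep:
  assumes "matroid E \<I>"
  shows max_weight_indep_in: "max_weight_indep \<I> w S \<in> \<I>"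
    and max_weight_indep_subset: "max_weight_indep \<I> w S \<subseteq> S"
    and max_weight_indep_ge: "\<And>A. A \<in> \<I> \<Longrightarrow> A \<subseteq> S \<Longrightarrow> sum w A \<le> sum w (max_weight_indep \<I> w S)"
proof -
  let ?C = "{A. A \<in> \<I> \<and> A \<subseteq> S}"
  have "finite ?C" using assms
    by (auto simp: matroid_def intro!: finite_subset[of _ "Pow E"])
  moreover have "{} \<in> ?C" using assms by (auto simp: matroid_def)
  ultimately have "Max (sum w ` ?C) \<in> sum w ` ?C" by (intro Max_in) auto
  then obtain A where "A \<in> ?C" "sum w A = Max (sum w ` ?C)" by auto
  then have "is_arg_max (sum w) (\<lambda>A. A \<in> \<I> \<and> A \<subseteq> S) A"
    using \<open>finite ?C\<close> by (auto simp: is_arg_max_def not_less)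
  then have "is_arg_max (sum w) (\<lambda>A. A \<in> \<I> \<and> A \<subseteq> S) (max_weight_indep \<I> w S)"
    unfolding max_weight_indep_def arg_max_def by (auto intro: someI)
  then show "max_weight_indep \<I> w S \<in> \<I>" "max_weight_indep \<I> w S \<subseteq> S"
    "\<And>A. A \<in> \<I> \<Longrightarrow> A \<subseteq> S \<Longrightarrow> sum w A \<le> sum w (max_weight_indep \<I> w S)"
    unfolding is_arg_max_def by (auto simp: not_less)
qed

text \<open>Exchange argument. If \<open>J\<close> were larger, some \<open>y\<close> of
  \<open>J\<close> could be added to \<open>A \<inter> U\<close>, and the result extended from
  \<open>A\<close> to a set \<open>L\<close> at least as large as \<open>A\<close>. Then
  \<open>L\<close> is \<open>A\<close> plus \<open>y\<close>, heavier by positivity, or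
  \<open>A\<close> plus \<open>y\<close> minus an element outside \<open>U\<close>, which is lighter
  than \<open>y\<close>.\<close>

lemma card_heavy_indep_le:
  assumes M: "matroid E \<I>" and pos: "\<And>x. x \<in> S \<Longrightarrow> w x > 0"
    and up: "\<And>x y. x \<in> U \<Longrightarrow> x \<in> S \<Longrightarrow> y \<in> S - U \<Longrightarrow> w y < w x"
    and J: "J \<in> \<I>" "J \<subseteq> S \<inter> U"
  shows "card J \<le> card (max_weight_indep \<I> w S \<inter> U)"
proof (rule ccontr)
  define A where "A = max_weight_indep \<I> w S"
  note A = max_weight_indep[OF M, where w = w and S = S, folded A_def]
  have fin: "finite B" if "B \<in> \<I>" for B
    using M that by (auto simp: matroid_def intro: finite_subset)
  have AU: "A \<inter> U \<in> \<I>" using M A(1) by (auto simp: matroid_def)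
  assume "\<not> card J \<le> card (max_weight_indep \<I> w S \<inter> U)"
  then have "card (A \<inter> U) < card J" by (simp add: A_def)
  then obtain y where y: "y \<in> J - A \<inter> U" "insert y (A \<inter> U) \<in> \<I>"
    using M J AU unfolding matroid_def by blast
  have yA: "y \<in> S" "y \<in> U" "y \<notin> A" using y J by auto
  obtain L where L: "L \<in> \<I>" "insert y (A \<inter> U) \<subseteq> L" "L \<subseteq> A \<union> insert y (A \<inter> U)" "card A \<le> card L"
    using matroid_extend[OF M A(1) y(2)] by metis
  then have LS: "L \<subseteq> S" "L \<subseteq> insert y A" using A(2) yA by auto
  have finA: "finite A" using fin A by blast
  have "sum w A < sum w L"
  proof (cases "A \<subseteq> L")
    case True
    then have "L = insert y A" using L LS by auto
    then show ?thesis using finA yA pos by simp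
  next
    case False
    then obtain z where z: "z \<in> A" "z \<notin> L" by blast
    then have zU: "z \<in> S - U" using A(2) L by auto
    have "L = insert y (A - {z})"
    proof (rule card_subset_eq)
      show "L \<subseteq> insert y (A - {z})" using LS z by auto
      then have "card L \<le> card (insert y (A - {z}))"
        using finA by (intro card_mono) auto
      moreover have "card (insert y (A - {z})) = card A"
        using card_Suc_Diff1[OF finA z(1)] finA yA by simp
      ultimately show "card L = card (insert y (A - {z}))" using L(4) by simp
    qed (use finA in auto)
    then have "sum w L = w y + sum w A - w z"
      using finA yA z by (simp add: sum_diff1)
    then show ?thesis using up[OF yA(2,1) zU] by simp
  qed
  then show False using A(3)[OF L(1) LS(1)] by simp
qed

text \<open>If \<open>e\<close> were missing from the optimum \<open>A\<close> of \<open>S\<close>,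
  it would depend on the heavier elements of \<open>A\<close>. Extending these from
  \<open>insert e (Opt \<inter> H)\<close> to a set of at least that size must then avoid
  \<open>e\<close>, which gives an independent set of heavier elements too large for
  \<open>card_heavy_indep_le\<close>.\<close>

lemma max_weight_indep_restrict:
  assumes M: "matroid E \<I>" and pos: "\<And>x. x \<in> E \<Longrightarrow> w x > 0" and inj: "inj_on w E"
    and e: "e \<in> max_weight_indep \<I> w E" "e \<in> S" and SE: "S \<subseteq> E"
  shows "e \<in> max_weight_indep \<I> w S"
proof (rule ccontr)
  define A where "A = max_weight_indep \<I> w S"
  define Opt where "Opt = max_weight_indep \<I> w E"
  note A = max_weight_indep[OF M, where w = w and S = S, folded A_def]
  note O = max_weight_indep[OF M, where w = w and S = E, folded Opt_def]
  have fin: "finite B" if "B \<in> \<I>" for B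
    using M that by (auto simp: matroid_def intro: finite_subset)
  have down: "B \<in> \<I>" if "C \<in> \<I>" "B \<subseteq> C" for B C
    using M that by (auto simp: matroid_def)
  assume "e \<notin> max_weight_indep \<I> w S"
  then have eA: "e \<notin> A" by (simp add: A_def)
  define H where "H = {x. w x > w e}"
  define H' where "H' = {x. w x \<ge> w e}"
  \<comment> \<open>Distinct weights make \<open>e\<close> the only element of \<open>E\<close> of
    weight exactly \<open>w e\<close>.\<close>
  have "A \<inter> H' = A \<inter> H"
    using eA A(2) SE e inj by (auto simp: H_def H'_def inj_on_def order.order_iff_strict)
  moreover have "finite (A \<inter> H)" using fin[OF A(1)] by simp
  ultimately have "\<not> card (insert e (A \<inter> H)) \<le> card (A \<inter> H')"
    using eA by simp
  then have dep: "insert e (A \<inter> H) \<notin> \<I>"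
  proof (rule contrapos_nn)
    assume "insert e (A \<inter> H) \<in> \<I>"
    then show "card (insert e (A \<inter> H)) \<le> card (A \<inter> H')"
      unfolding A_def using pos SE e(2) max_weight_indep_subset[OF M, of w S]
      by (intro card_heavy_indep_le[OF M]) (auto simp: H_def H'_def)
  qed
  have O1: "insert e (Opt \<inter> H) \<in> \<I>" using e by (intro down[OF O(1)]) (auto simp: Opt_def)
  have AH: "A \<inter> H \<in> \<I>" by (intro down[OF A(1)]) auto
  obtain J where J: "J \<in> \<I>" "A \<inter> H \<subseteq> J" "J \<subseteq> insert e (Opt \<inter> H) \<union> (A \<inter> H)"
    "card (insert e (Opt \<inter> H)) \<le> card J"
    using matroid_extend[OF M O1 AH] by metis
  have "e \<notin> J" using dep down[OF J(1), of "insert e (A \<inter> H)"] J(2) by blast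
  then have "card J \<le> card (Opt \<inter> H)"
    unfolding Opt_def using J(1,3) A(2) O(2) SE pos
    by (intro card_heavy_indep_le[OF M]) (auto simp: H_def)
  moreover have "e \<notin> Opt \<inter> H" by (simp add: H_def)
  ultimately show False using J(4) fin[OF O(1)] by simp
qed

subsection \<open>The greedy algorithm\<close>

text \<open>The candidates that greedy may have taken before time \<open>t\<close>, whether or not
  it rejected them: a bound on its selection that does not depend on past decisions.
  \<open>opt\<close> is arbitrary because the counting uses only a cardinality bound on it.\<close>

definition running_optima ::
  "('a set \<Rightarrow> 'a set) \<Rightarrow> real \<Rightarrow> real \<Rightarrow> 'a set \<Rightarrow> ('a \<Rightarrow> real) \<Rightarrow> 'a set" where
  "running_optima opt a t S \<tau> = {f\<in>S. a < \<tau> f \<and> \<tau> f < t \<and> f \<in> opt {g\<in>S. \<tau> g \<le> \<tau> f}}"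

lemma arrival_order:
  assumes "finite E"
  shows "set (arrival_order E \<tau>) = E" "distinct (arrival_order E \<tau>)"
    "sorted (map \<tau> (arrival_order E \<tau>))"
proof -
  obtain xs where "set xs = E" "distinct xs"
    using finite_distinct_list[OF assms] by blast
  then have "set (sort_key \<tau> xs) = E \<and> distinct (sort_key \<tau> xs) \<and> sorted (map \<tau> (sort_key \<tau> xs))"
    by simp
  then have "set (arrival_order E \<tau>) = E \<and> distinct (arrival_order E \<tau>) \<and>
      sorted (map \<tau> (arrival_order E \<tau>))"
    unfolding arrival_order_def by (rule someI)
  then show "set (arrival_order E \<tau>) = E" "distinct (arrival_order E \<tau>)"
    "sorted (map \<tau> (arrival_order E \<tau>))" by auto
qed

lemma foldl_greedy_step_mono: "A \<subseteq> foldl (greedy_step t\<^sub>0 E \<I> w \<tau>) A xs"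
proof (induction xs arbitrary: A)
  case (Cons x xs)
  have "A \<subseteq> greedy_step t\<^sub>0 E \<I> w \<tau> A x" by (auto simp: greedy_step_def)
  with Cons[of "greedy_step t\<^sub>0 E \<I> w \<tau> A x"] show ?case by simp
qed simp

lemma foldl_greedy_step_indep:
  "A \<in> \<I> \<Longrightarrow> foldl (greedy_step t\<^sub>0 E \<I> w \<tau>) A xs \<in> \<I>"
  by (induction xs arbitrary: A) (auto simp: greedy_step_def)

lemma foldl_greedy_step_subset:
  "foldl (greedy_step t\<^sub>0 E \<I> w \<tau>) A xs
    \<subseteq> A \<union> {f\<in>set xs. t\<^sub>0 < \<tau> f \<and> f \<in> max_weight_indep \<I> w (arrived E \<tau> (\<tau> f))}"
proof (induction xs arbitrary: A)
  case (Cons x xs)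
  have "greedy_step t\<^sub>0 E \<I> w \<tau> A x
    \<subseteq> A \<union> {f\<in>{x}. t\<^sub>0 < \<tau> f \<and> f \<in> max_weight_indep \<I> w (arrived E \<tau> (\<tau> f))}"
    by (auto simp: greedy_step_def)
  with Cons[of "greedy_step t\<^sub>0 E \<I> w \<tau> A x"] show ?case by simp blast
qed simp

text \<open>The set selected before \<open>e\<close> is independent and consists of running optima
  of \<open>E - {e}\<close>. Leaving \<open>e\<close> out makes these depend on the arrival time of
  \<open>e\<close> only through the end of the window.\<close>

lemma greedy_selects:
  assumes M: "matroid E \<I>" and e: "e \<in> E" "e \<in> max_weight_indep \<I> w (arrived E \<tau> (\<tau> e))"
    and inj: "inj_on \<tau> E" and nonneg: "\<And>f. f \<in> E \<Longrightarrow> 0 \<le> \<tau> f" and t: "t\<^sub>0 < \<tau> e"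
    and ins: "\<And>A. A \<in> \<I> \<Longrightarrow>
      A \<subseteq> running_optima (max_weight_indep \<I> w) t\<^sub>0 (\<tau> e) (E - {e}) \<tau> \<Longrightarrow> insert e A \<in> \<I>"
  shows "e \<in> greedy t\<^sub>0 E \<I> w \<tau>"
proof -
  let ?step = "greedy_step t\<^sub>0 E \<I> w \<tau>"
  have fin: "finite E" using M by (simp add: matroid_def)
  note xs = arrival_order[OF fin, of \<tau>]
  obtain ys zs where yz: "arrival_order E \<tau> = ys @ e # zs"
    using e(1) xs(1) split_list by metis
  define A where "A = foldl ?step {} ys"
  have "{} \<in> \<I>" using M by (simp add: matroid_def)
  then have AI: "A \<in> \<I>" unfolding A_def by (rule foldl_greedy_step_indep)
  have before: "f \<in> E" "f \<noteq> e" "\<tau> f < \<tau> e" if "f \<in> set ys" for f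
  proof -
    show f: "f \<in> E" "f \<noteq> e" using xs that yz by auto
    have "\<tau> f \<le> \<tau> e" using xs(3) that yz by (auto simp: sorted_append)
    moreover have "\<tau> f \<noteq> \<tau> e" using inj f e(1) by (auto dest: inj_onD)
    ultimately show "\<tau> f < \<tau> e" by simp
  qed
  have "A \<subseteq> running_optima (max_weight_indep \<I> w) t\<^sub>0 (\<tau> e) (E - {e}) \<tau>"
  proof
    fix f assume "f \<in> A"
    then have f: "f \<in> set ys" "t\<^sub>0 < \<tau> f" "f \<in> max_weight_indep \<I> w (arrived E \<tau> (\<tau> f))"
      using foldl_greedy_step_subset[of t\<^sub>0 E \<I> w \<tau> "{}" ys] by (auto simp: A_def)
    have "arrived E \<tau> (\<tau> f) = {g\<in>E - {e}. \<tau> g \<le> \<tau> f}"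
      using before[OF f(1)] nonneg by (auto simp: arrived_def)
    with f before[OF f(1)] show "f \<in> running_optima (max_weight_indep \<I> w) t\<^sub>0 (\<tau> e) (E - {e}) \<tau>"
      by (simp add: running_optima_def)
  qed
  then have "insert e A \<in> \<I>" using ins AI by blast
  then have "?step A e = insert e A" using t e(2) by (simp add: greedy_step_def)
  then have "greedy t\<^sub>0 E \<I> w \<tau> = foldl ?step (insert e A) zs"
    by (simp add: greedy_def yz A_def)
  then show ?thesis using foldl_greedy_step_mono[of "insert e A" t\<^sub>0 E \<I> w \<tau> zs] by auto
qed

text \<open>All capacity constraints that can block \<open>e\<close> come from the chain of members containing \<open>e\<close>;
  among those with equal capacity only the largest one matters.\<close>

lemma laminar_blocking_sets:
  assumes fin: "finite E" and lam: "laminar_family E \<F>" and I: "\<I> = laminar_indep E \<F> c"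
    and e: "{e} \<in> \<I>"
  obtains K :: "nat set" and D :: "nat \<Rightarrow> 'a set"
  where "finite K" "0 \<notin> K" "\<And>k S. k \<in> K \<Longrightarrow> S \<in> \<I> \<Longrightarrow> card (S \<inter> D k) \<le> k"
    "\<And>A. A \<in> \<I> \<Longrightarrow> (\<And>k. k \<in> K \<Longrightarrow> card (A \<inter> D k) < k) \<Longrightarrow> insert e A \<in> \<I>"
proof -
  define \<C> where "\<C> = {B\<in>\<F>. e \<in> B}"
  have finC: "finite \<C>"
    using lam fin by (auto simp: \<C>_def laminar_family_def intro: finite_subset[of _ "Pow E"])
  define K where "K = c ` \<C>"
  have "\<exists>D\<in>\<C>. c D = k \<and> (\<forall>B\<in>\<C>. c B = k \<longrightarrow> B \<subseteq> D)" if "k \<in> K" for k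
  proof -
    let ?X = "{B\<in>\<C>. c B = k}"
    have "finite ?X" "?X \<noteq> {}" using finC that by (auto simp: K_def)
    then obtain D where D: "D \<in> ?X" "\<forall>B\<in>?X. D \<subseteq> B \<longrightarrow> D = B"
      using finite_has_maximal[of ?X] by blast
    \<comment> \<open>Both sets contain \<open>e\<close>, so laminarity makes them nested and a
      maximal set is the largest one.\<close>
    have "B \<subseteq> D" if "B \<in> ?X" for B
    proof -
      have "B \<subseteq> D \<or> D \<subseteq> B \<or> B \<inter> D = {}" if "B \<noteq> D"
        using lam that \<open>B \<in> ?X\<close> D(1) by (auto simp: laminar_family_def \<C>_def)
      moreover have "e \<in> B \<inter> D" using that D(1) by (auto simp: \<C>_def)
      ultimately show ?thesis using D(2) that by blast
    qed
    with D(1) show ?thesis by blast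
  qed
  then obtain D where D: "\<And>k. k \<in> K \<Longrightarrow> D k \<in> \<C> \<and> c (D k) = k \<and> (\<forall>B\<in>\<C>. c B = k \<longrightarrow> B \<subseteq> D k)"
    by metis
  show ?thesis
  proof
    show "finite K" using finC by (simp add: K_def)
    show "0 \<notin> K"
    proof
      assume "0 \<in> K"
      then have "D 0 \<in> \<F>" "e \<in> D 0" "c (D 0) = 0" using D by (auto simp: \<C>_def)
      then show False using e by (fastforce simp: I laminar_indep_def)
    qed
    show "card (S \<inter> D k) \<le> k" if "k \<in> K" "S \<in> \<I>" for k S
      using D[OF that(1)] that(2) by (auto simp: I laminar_indep_def \<C>_def)
    show "insert e A \<in> \<I>" if A: "A \<in> \<I>" and less: "\<And>k. k \<in> K \<Longrightarrow> card (A \<inter> D k) < k" for A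
    proof -
      have finA: "finite A" using A fin by (auto simp: I laminar_indep_def intro: finite_subset)
      have "card (insert e A \<inter> B) \<le> c B" if B: "B \<in> \<F>" for B
      proof (cases "e \<in> B")
        case False
        then show ?thesis using A B by (simp add: I laminar_indep_def)
      next
        case True
        then have BC: "B \<in> \<C>" "c B \<in> K" using B by (auto simp: \<C>_def K_def)
        then have "card (A \<inter> B) \<le> card (A \<inter> D (c B))"
          using D finA by (intro card_mono) auto
        also have "\<dots> < c B" using less BC by blast
        finally show ?thesis
          using True finA card_insert_le_m1 by (simp add: card_insert_if)
      qed
      moreover have "insert e A \<subseteq> E" using A e by (auto simp: I laminar_indep_def)
      ultimately show ?thesis by (simp add: I laminar_indep_def)
    qed
  qed
qed

text \<open>The predicates under \<open>SOME\<close> in \<open>arrival_order\<close> coincide, hence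
  so do the chosen orders, even with ties; the same comparisons decide the threshold test and the
  sets \<open>arrived\<close>.\<close>

lemma greedy_cong:
  assumes fin: "finite E"
    and ord: "\<And>a b. a \<in> E \<Longrightarrow> b \<in> E \<Longrightarrow> \<tau> a \<le> \<tau> b \<longleftrightarrow> \<tau>' a \<le> \<tau>' b"
    and late: "\<And>a. a \<in> E \<Longrightarrow> t\<^sub>0 < \<tau> a \<longleftrightarrow> t\<^sub>0 < \<tau>' a"
    and nonneg: "\<And>a. a \<in> E \<Longrightarrow> 0 \<le> \<tau> a \<longleftrightarrow> 0 \<le> \<tau>' a"
  shows "greedy t\<^sub>0 E \<I> w \<tau> = greedy t\<^sub>0 E \<I> w \<tau>'"
proof -
  have "sorted (map \<tau> xs) \<longleftrightarrow> sorted (map \<tau>' xs)" if "set xs = E" for xs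
    using ord that by (auto simp: sorted_wrt_map intro: sorted_wrt_mono_rel[rotated])
  then have "(\<lambda>xs. set xs = E \<and> distinct xs \<and> sorted (map \<tau> xs))
      = (\<lambda>xs. set xs = E \<and> distinct xs \<and> sorted (map \<tau>' xs))" by auto
  then have "arrival_order E \<tau> = arrival_order E \<tau>'"
    by (simp add: arrival_order_def)
  moreover have "greedy_step t\<^sub>0 E \<I> w \<tau> A x = greedy_step t\<^sub>0 E \<I> w \<tau>' A x" if "x \<in> E" for A x
  proof -
    have "arrived E \<tau> (\<tau> x) = arrived E \<tau>' (\<tau>' x)"
      using ord nonneg that by (auto simp: arrived_def)
    then show ?thesis using late that by (simp add: greedy_step_def)
  qed
  ultimately show ?thesis
    unfolding greedy_def using arrival_order(1)[OF fin] by (intro foldl_cong) auto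
qed

subsection \<open>Random arrival times\<close>

lemma measurable_Collect_finite:
  assumes "finite I" "\<And>i. i \<in> I \<Longrightarrow> Measurable.pred M (P i)"
  shows "(\<lambda>x. {i\<in>I. P i x}) \<in> M \<rightarrow>\<^sub>M count_space UNIV"
proof -
  have "(\<lambda>x. {i\<in>I. P i x}) \<in> M \<rightarrow>\<^sub>M count_space (Pow I)"
  proof (subst measurable_count_space_eq2)
    show "finite (Pow I)" using assms by simp
    have "(\<lambda>x. {i\<in>I. P i x}) -` {J} \<inter> space M \<in> sets M" if "J \<in> Pow I" for J
    proof -
      have "(\<lambda>x. {i\<in>I. P i x}) -` {J} \<inter> space M = {x\<in>space M. \<forall>i\<in>I. P i x \<longleftrightarrow> i \<in> J}"
        using that by auto
      also have "\<dots> \<in> sets M"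
        using assms by measurable
      finally show ?thesis .
    qed
    then show "(\<lambda>x. {i\<in>I. P i x}) \<in> space M \<rightarrow> Pow I \<and>
      (\<forall>J\<in>Pow I. (\<lambda>x. {i\<in>I. P i x}) -` {J} \<inter> space M \<in> sets M)"
      by auto
  qed
  then show ?thesis by (rule measurable_compose) simp
qed

section \<open>The product measure of independent uniform arrival times\<close>

abbreviation unif :: "real measure" where
  "unif \<equiv> uniform_measure lborel {0..1}"

lemma prob_space_unif: "prob_space unif"
  by (rule prob_space_uniform_measure) auto

interpretation unif: product_prob_space "\<lambda>_. unif" UNIV
  by (intro product_prob_spaceI prob_space_unif)

lemma measurable_arrival_component [measurable]:
  "i \<in> S \<Longrightarrow> (\<lambda>\<tau>. \<tau> i) \<in> borel_measurable (arrival_measure S)"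
  using measurable_component_singleton[of i S "\<lambda>_. unif"]
  by (simp add: arrival_measure_def cong: measurable_cong_sets)

lemma pred_arrival_le:
  assumes "f \<in> S" "g \<in> S"
  shows "Measurable.pred (arrival_measure S) (\<lambda>\<tau>. \<tau> f \<le> \<tau> g)"
  unfolding pred_def by (intro borel_measurable_le measurable_arrival_component assms)

lemma space_arrival_measure: "space (arrival_measure S) = extensional S"
  by (simp add: arrival_measure_def space_PiM PiE_UNIV_domain PiE_def)

lemma prob_space_arrival_measure: "prob_space (arrival_measure S)"
  unfolding arrival_measure_def by (intro prob_space_PiM prob_space_unif)

text \<open>Tonelli's theorem with the arrival time \<open>s\<close> of \<open>e\<close> outermost;
  used for the last arrival in the induction and for the final integral over the arrival time of the
  optimal element.\<close>

lemma emeasure_arrival_insert: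
  assumes "finite S" "e \<notin> S" and A: "A \<in> sets (arrival_measure (insert e S))"
  shows "emeasure (arrival_measure (insert e S)) A
    = (\<integral>\<^sup>+s. emeasure (arrival_measure S) {\<tau>\<in>space (arrival_measure S). \<tau>(e := s) \<in> A} * indicator {0..1} s \<partial>lborel)"
proof -
  note A' [measurable] = A[unfolded arrival_measure_def]
  have "emeasure (arrival_measure (insert e S)) A
      = (\<integral>\<^sup>+\<tau>. indicator A \<tau> \<partial>(\<Pi>\<^sub>M i\<in>insert e S. unif))"
    using A by (simp add: arrival_measure_def)
  also have "\<dots> = (\<integral>\<^sup>+s. \<integral>\<^sup>+\<tau>. indicator A (\<tau>(e := s)) \<partial>(\<Pi>\<^sub>M i\<in>S. unif) \<partial>unif)"
    by (rule unif.product_nn_integral_insert_rev) (use assms in auto)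
  also have "\<dots> = (\<integral>\<^sup>+s. (\<integral>\<^sup>+\<tau>. indicator A (\<tau>(e := s)) \<partial>(\<Pi>\<^sub>M i\<in>S. unif)) * indicator {0..1} s \<partial>lborel)"
  proof -
    interpret S: prob_space "\<Pi>\<^sub>M i\<in>S. unif"
      by (intro prob_space_PiM prob_space_unif)
    have "(\<lambda>x. (snd x)(e := fst x)) \<in> unif \<Otimes>\<^sub>M (\<Pi>\<^sub>M i\<in>S. unif) \<rightarrow>\<^sub>M (\<Pi>\<^sub>M i\<in>insert e S. unif)"
      by (rule measurable_fun_upd[where J = S]) auto
    from measurable_compose[OF this borel_measurable_indicator[OF A']]
    have "(\<lambda>(s, \<tau>). indicator A (\<tau>(e := s)) :: ennreal) \<in> borel_measurable (unif \<Otimes>\<^sub>M (\<Pi>\<^sub>M i\<in>S. unif))"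
      by (simp only: case_prod_unfold)
    then have "(\<lambda>s. \<integral>\<^sup>+\<tau>. indicator A (\<tau>(e := s)) \<partial>(\<Pi>\<^sub>M i\<in>S. unif)) \<in> borel_measurable unif"
      by (rule S.borel_measurable_nn_integral)
    then show ?thesis
      by (subst nn_integral_uniform_measure) (simp_all add: divide_ennreal_def cong: measurable_cong_sets)
  qed
  also have "\<dots> = (\<integral>\<^sup>+s. emeasure (arrival_measure S) {\<tau>\<in>space (arrival_measure S). \<tau>(e := s) \<in> A} * indicator {0..1} s \<partial>lborel)"
  proof (intro nn_integral_cong arg_cong2[where f = "(*)"] refl)
    fix s :: real
    have "(\<integral>\<^sup>+\<tau>. indicator A (\<tau>(e := s)) \<partial>(\<Pi>\<^sub>M i\<in>S. unif))
        = (\<integral>\<^sup>+\<tau>. indicator {\<tau>\<in>space (arrival_measure S). \<tau>(e := s) \<in> A} \<tau> \<partial>arrival_measure S)"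
      unfolding arrival_measure_def by (intro nn_integral_cong) (auto simp: indicator_def)
    also have "\<dots> = emeasure (arrival_measure S) {\<tau>\<in>space (arrival_measure S). \<tau>(e := s) \<in> A}"
      unfolding arrival_measure_def
      by (rule nn_integral_indicator) measurable
    finally show "(\<integral>\<^sup>+\<tau>. indicator A (\<tau>(e := s)) \<partial>(\<Pi>\<^sub>M i\<in>S. unif)) = \<dots>" .
  qed
  finally show ?thesis .
qed

section \<open>Measurability of events about running optima\<close>

lemma measurable_running_optima:
  assumes S: "finite S" "S \<subseteq> S'" and t [measurable]: "t \<in> borel_measurable (arrival_measure S')"
  shows "(\<lambda>\<tau>. running_optima opt a (t \<tau>) S \<tau>) \<in> arrival_measure S' \<rightarrow>\<^sub>M count_space UNIV"
  unfolding running_optima_def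
proof (intro measurable_Collect_finite S)
  fix f assume f: "f \<in> S"
  have [simp]: "(\<lambda>\<tau>. \<tau> f) \<in> borel_measurable (arrival_measure S')"
    using f S by (intro measurable_arrival_component) auto
  have "(\<lambda>\<tau>. {g\<in>S. \<tau> g \<le> \<tau> f}) \<in> arrival_measure S' \<rightarrow>\<^sub>M count_space UNIV"
    using f S by (intro measurable_Collect_finite pred_arrival_le) auto
  then have *: "Measurable.pred (arrival_measure S') (\<lambda>\<tau>. f \<in> opt {g\<in>S. \<tau> g \<le> \<tau> f})"
    by (rule measurable_compose[where g = "\<lambda>X. f \<in> opt X"]) simp
  show "Measurable.pred (arrival_measure S') (\<lambda>\<tau>. a < \<tau> f \<and> \<tau> f < t \<tau> \<and> f \<in> opt {g\<in>S. \<tau> g \<le> \<tau> f})"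
    using t f(1) S by (intro pred_intros_logic *) (auto simp: pred_def intro!: borel_measurable_less)
qed

lemma pred_inj_on_arrival:
  assumes S: "finite S" "S \<subseteq> S'"
  shows "Measurable.pred (arrival_measure S') (\<lambda>\<tau>. inj_on \<tau> S)"
proof -
  have "inj_on \<tau> S \<longleftrightarrow> (\<forall>x\<in>S. \<forall>y\<in>S - {x}. \<not> (\<tau> x \<le> \<tau> y \<and> \<tau> y \<le> \<tau> x))" for \<tau> :: "'a \<Rightarrow> real"
    unfolding inj_on_def by fastforce
  then show ?thesis
    using S by (auto intro!: pred_intros_finite pred_intros_logic pred_arrival_le simp only:)
qed

lemma pred_card_running_optima:
  assumes "finite S" "S \<subseteq> S'" "t \<in> borel_measurable (arrival_measure S')"
  shows "Measurable.pred (arrival_measure S') (\<lambda>\<tau>. k \<le> card (B \<inter> running_optima opt a (t \<tau>) S \<tau>))"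
  by (rule measurable_compose[OF measurable_running_optima[OF assms], where g = "\<lambda>X. k \<le> card (B \<inter> X)"]) simp

text \<open>The rate at which running optima appear at time \<open>s\<close> is at most \<open>c / s\<close>; integrated over the
  observation window from \<open>a\<close> to \<open>t\<close>, this is the mean of the dominating Poisson variable.\<close>

definition window_mean :: "real \<Rightarrow> real \<Rightarrow> nat \<Rightarrow> real \<Rightarrow> real" where
  "window_mean a t c s = real c * ln (max a (min s t) / a)"

lemma window_mean_nonneg: "0 < a \<Longrightarrow> 0 \<le> window_mean a t c s"
  by (simp add: window_mean_def)

section \<open>Poisson domination of the number of running optima\<close>

lemma has_integral_poisson_tail_recursion:
  assumes a: "0 < a" "a < t" and T: "0 \<le> T" and n: "0 < n"
  shows "((\<lambda>s. s ^ (n - 1) * (real n * poisson_tail k (window_mean a t c s)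
      + (if a < s \<and> s < t then real c * (poisson_tail (k - 1) (window_mean a t c s)
          - poisson_tail k (window_mean a t c s)) else 0)))
    has_integral T ^ n * poisson_tail k (window_mean a t c T)) {0..T}"
proof -
  \<comment> \<open>The integrand \<open>f\<close> is the derivative of \<open>F\<close>:
    \<open>window_mean\<close> has derivative \<open>c / s\<close> inside the window and is constant
    outside, while the derivative of \<open>poisson_tail\<close> is the difference of neighbouring
    tails.\<close>
  define F where "F s = s ^ n * poisson_tail k (window_mean a t c s)" for s
  define f where "f s = s ^ (n - 1) * (real n * poisson_tail k (window_mean a t c s)
      + (if a < s \<and> s < t then real c * (poisson_tail (k - 1) (window_mean a t c s)
          - poisson_tail k (window_mean a t c s)) else 0))" for s
  have cont: "continuous_on {0..T} F"
    unfolding F_def window_mean_def using a by (intro continuous_intros) (auto simp: max_def)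
  have const: "(F has_real_derivative f s) (at s)"
    if U: "open U" "s \<in> U" "\<And>x. x \<in> U \<Longrightarrow> window_mean a t c x = m" "\<not> (a < s \<and> s < t)" for s m U
  proof -
    have "((\<lambda>s. s ^ n * poisson_tail k m) has_real_derivative f s) (at s)"
      using U by (auto intro!: derivative_eq_intros simp: f_def)
    then show ?thesis
      by (rule has_field_derivative_transform_within_open[OF _ U(1,2)]) (simp add: F_def U(3))
  qed
  have deriv: "(F has_real_derivative f s) (at s)" if s: "s \<in> {0..T} - {a, t}" for s
  proof -
    consider "s < a" | "a < s" "s < t" | "t < s" using s by force
    then show ?thesis
    proof cases
      case 1
      then show ?thesis
        using a by (intro const[of "{..<a}" _ 0]) (auto simp: window_mean_def)
    next
      case 3
      then show ?thesis
        using a by (intro const[of "{t<..}" _ "real c * ln (t / a)"]) (auto simp: window_mean_def)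
    next
      case 2
      have wm: "window_mean a t c x = real c * ln (x / a)" if "x \<in> {a<..<t}" for x
        using that by (simp add: window_mean_def)
      have "((\<lambda>x. real c * ln (x / a)) has_real_derivative real c / s) (at s)"
        using 2 a by (auto intro!: derivative_eq_intros)
      from DERIV_chain[OF has_real_derivative_poisson_tail this, of k]
      have *: "((\<lambda>x. poisson_tail k (real c * ln (x / a))) has_real_derivative
          (poisson_tail (k - 1) (window_mean a t c s) - poisson_tail k (window_mean a t c s)) * (real c / s)) (at s)"
        using 2 by (simp add: wm o_def)
      have "((\<lambda>x. x ^ n * poisson_tail k (real c * ln (x / a))) has_real_derivative
          real n * s ^ (n - 1) * poisson_tail k (real c * ln (s / a)) +
          (poisson_tail (k - 1) (window_mean a t c s) - poisson_tail k (window_mean a t c s)) * (real c / s) * s ^ n) (at s)"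
        by (rule DERIV_mult[OF _ *]) (auto intro!: derivative_eq_intros)
      also have "real n * s ^ (n - 1) * poisson_tail k (real c * ln (s / a)) +
          (poisson_tail (k - 1) (window_mean a t c s) - poisson_tail k (window_mean a t c s)) * (real c / s) * s ^ n = f s"
      proof -
        have "s ^ n = s * s ^ (n - 1)" using n by (metis power_eq_if gr_implies_not0)
        then show ?thesis using 2 a by (simp add: f_def wm algebra_simps)
      qed
      finally show ?thesis
        by (rule has_field_derivative_transform_within_open[of _ _ _ "{a<..<t}"])
           (use 2 in \<open>auto simp: F_def wm\<close>)
    qed
  qed
  \<comment> \<open>The clamped mean may have kinks at \<open>a\<close> and \<open>t\<close>, so
    only continuity of \<open>F\<close> is used there.\<close>
  have "(f has_integral (F T - F 0)) {0..T}"
    by (rule fundamental_theorem_of_calculus_strong[where S = "{a, t}"])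
       (use T cont deriv in \<open>auto simp: has_real_derivative_iff_has_vector_derivative\<close>)
  then show ?thesis using n by (simp add: F_def f_def[abs_def] power_0_left)
qed

text \<open>Whether an earlier arrival is a running optimum depends only on arrivals up to its own
  time, so a last arrival leaves the others unchanged; injectivity excludes ties with
  \<open>s\<close>.\<close>

lemma running_optima_insert_last:
  assumes inj: "inj_on (\<tau>(e := s)) (insert e S)" and e: "e \<notin> S" and last: "\<And>f. f \<in> S \<Longrightarrow> \<tau> f \<le> s"
  shows "running_optima opt a t (insert e S) (\<tau>(e := s))
    = running_optima opt a t S \<tau> \<union> (if a < s \<and> s < t \<and> e \<in> opt (insert e S) then {e} else {})"
proof -
  have ne: "\<tau> f \<noteq> s" if "f \<in> S" for f
    using inj_onD[OF inj, of f e] that e by auto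
  have less: "\<tau> f < s" if "f \<in> S" for f using last[OF that] ne[OF that] by simp
  have upd: "(\<tau>(e := s)) f = \<tau> f" if "f \<in> S" for f using that e by auto
  have "{g \<in> insert e S. (\<tau>(e := s)) g \<le> \<tau> f} = {g\<in>S. \<tau> g \<le> \<tau> f}" if "f \<in> S" for f
    using less[OF that] e upd by auto
  moreover have "{g \<in> insert e S. (\<tau>(e := s)) g \<le> s} = insert e S"
    using last upd by auto
  ultimately show ?thesis
    unfolding running_optima_def using e by (auto simp: upd simp del: fun_upd_apply simp: fun_upd_same)
qed

text \<open>Induction on the number of elements. Split by which element \<open>e\<close> arrives
  last and at what time \<open>s\<close>: the others all arrive by \<open>s\<close>, so the
  hypothesis applies with \<open>T = s\<close>, and with \<open>k - 1\<close> in place of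
  \<open>k\<close> if \<open>e\<close> itself is counted. At most \<open>c\<close> choices of
  \<open>e\<close> can be counted, so the sum over \<open>e\<close> is at most the integrand of
  \<open>has_integral_poisson_tail_recursion\<close>. The factor \<open>T ^ card S\<close> is the
  probability that all elements arrive by \<open>T\<close>, which avoids conditional
  probabilities.\<close>

lemma emeasure_running_optima_le:
  fixes opt :: "'a set \<Rightarrow> 'a set"
  assumes a: "0 < a" "a < t" and opt: "\<And>S. S \<subseteq> E \<Longrightarrow> card (S \<inter> opt S \<inter> B) \<le> c"
    and S: "finite S" "S \<subseteq> E" and T: "0 \<le> T" "T \<le> 1"
  shows "emeasure (arrival_measure S)
      {\<tau>\<in>space (arrival_measure S). inj_on \<tau> S \<and> (\<forall>f\<in>S. \<tau> f \<le> T) \<and>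
        k \<le> card (B \<inter> running_optima opt a t S \<tau>)}
    \<le> ennreal (T ^ card S * poisson_tail k (window_mean a t c T))"
  using S T
proof (induction "card S" arbitrary: S k T)
  case 0
  interpret prob_space "arrival_measure S" by (rule prob_space_arrival_measure)
  have S: "S = {}" using 0 by simp
  show ?case
  proof (cases k)
    case 0
    then show ?thesis using S emeasure_le_1[of "space (arrival_measure S)"] by simp
  next
    case (Suc j)
    then show ?thesis using S by (simp add: running_optima_def)
  qed
next
  case (Suc n)
  note S = \<open>finite S\<close> \<open>S \<subseteq> E\<close>
  let ?M = "arrival_measure S"
  define q where "q k s = poisson_tail k (window_mean a t c s)" for k s
  have q0: "0 \<le> q k s" for k s
    unfolding q_def by (intro poisson_tail_nonneg window_mean_nonneg a)
  have q1: "q k s \<le> q (k - 1) s" for k s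
    unfolding q_def by (intro poisson_tail_pred_ge window_mean_nonneg a)
  \<comment> \<open>Equals 1 if \<open>e\<close>, arriving last at time \<open>s\<close>, is itself
    counted: the running optimum at that moment is \<open>opt S\<close>.\<close>
  define b where "b e s = (if a < s \<and> s < t \<and> e \<in> opt S \<inter> B then 1 else 0 :: nat)" for e s
  define A where "A e = {\<tau>\<in>space ?M. inj_on \<tau> S \<and> (\<forall>f\<in>S. \<tau> f \<le> \<tau> e) \<and> \<tau> e \<le> T \<and>
        k \<le> card (B \<inter> running_optima opt a t S \<tau>)}" for e
  have A_sets: "A e \<in> sets ?M" if e: "e \<in> S" for e
  proof -
    have "Measurable.pred ?M (\<lambda>\<tau>. \<tau> e \<le> T)"
      unfolding pred_def using e by (intro borel_measurable_le measurable_arrival_component) auto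
    then have "Measurable.pred ?M (\<lambda>\<tau>. inj_on \<tau> S \<and> (\<forall>f\<in>S. \<tau> f \<le> \<tau> e) \<and> \<tau> e \<le> T \<and>
        k \<le> card (B \<inter> running_optima opt a t S \<tau>))"
      using e S by (intro pred_intros_logic pred_intros_finite pred_inj_on_arrival pred_arrival_le
        pred_card_running_optima) auto
    then show ?thesis unfolding A_def pred_def .
  qed
  have A_le: "emeasure ?M (A e) \<le> (\<integral>\<^sup>+s. ennreal (s ^ n * q (k - b e s) s) * indicator {0..T} s \<partial>lborel)"
    if e: "e \<in> S" for e
  proof -
    define S' where "S' = S - {e}"
    have S': "S = insert e S'" "e \<notin> S'" "finite S'" "S' \<subseteq> E" "card S' = n"
      using e S Suc.hyps(2) by (auto simp: S'_def)
    have "emeasure ?M (A e) = (\<integral>\<^sup>+s. emeasure (arrival_measure S')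
        {\<tau>\<in>space (arrival_measure S'). \<tau>(e := s) \<in> A e} * indicator {0..1} s \<partial>lborel)"
      using emeasure_arrival_insert[OF S'(3,2)] A_sets[OF e] unfolding S'(1) by simp
    also have "\<dots> \<le> (\<integral>\<^sup>+s. ennreal (s ^ n * q (k - b e s) s) * indicator {0..T} s \<partial>lborel)"
    proof (rule nn_integral_mono)
      fix s :: real
      let ?X = "{\<tau>\<in>space (arrival_measure S'). \<tau>(e := s) \<in> A e}"
      let ?Y = "{\<tau>\<in>space (arrival_measure S'). inj_on \<tau> S' \<and> (\<forall>f\<in>S'. \<tau> f \<le> s) \<and>
        k - b e s \<le> card (B \<inter> running_optima opt a t S' \<tau>)}"
      have XY: "s \<le> T \<and> \<tau> \<in> ?Y" if "\<tau> \<in> ?X" for \<tau>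
      proof -
        have \<tau>: "inj_on (\<tau>(e := s)) (insert e S')" "\<And>f. f \<in> S' \<Longrightarrow> \<tau> f \<le> s" "s \<le> T"
          "k \<le> card (B \<inter> running_optima opt a t (insert e S') (\<tau>(e := s)))"
          using that S'(2) unfolding A_def S'(1) by (auto simp: if_split_mem1 split: if_splits)
        have "inj_on \<tau> S'"
        proof (rule inj_onI)
          fix x y assume xy: "x \<in> S'" "y \<in> S'" "\<tau> x = \<tau> y"
          then have "x \<noteq> e" "y \<noteq> e" using S'(2) by auto
          with xy show "x = y" using inj_onD[OF \<tau>(1), of x y] by simp
        qed
        moreover have "k \<le> card (B \<inter> running_optima opt a t S' \<tau>) + b e s"
        proof -
          note \<tau>(4)
          also have "B \<inter> running_optima opt a t (insert e S') (\<tau>(e := s))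
            = (B \<inter> running_optima opt a t S' \<tau>) \<union> (if b e s = 1 then {e} else {})"
            using running_optima_insert_last[OF \<tau>(1) S'(2), of opt a t] \<tau>(2)
            by (auto simp: b_def S'(1))
          also have "card \<dots> \<le> card (B \<inter> running_optima opt a t S' \<tau>) + card (if b e s = 1 then {e} else {})"
            by (rule card_Un_le)
          also have "card (if b e s = 1 then {e} else {}) \<le> b e s" by (simp add: b_def)
          finally show ?thesis by simp
        qed
        ultimately show ?thesis using that \<tau> by auto
      qed
      show "emeasure (arrival_measure S') ?X * indicator {0..1} s
        \<le> ennreal (s ^ n * q (k - b e s) s) * indicator {0..T} s"
      proof (cases "s \<in> {0..T}")
        case True
        have Y: "?Y \<in> sets (arrival_measure S')"
        proof -
          have "Measurable.pred (arrival_measure S') (\<lambda>\<tau>. \<tau> f \<le> s)" if "f \<in> S'" for f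
            unfolding pred_def using that by (intro borel_measurable_le measurable_arrival_component) auto
          then have "Measurable.pred (arrival_measure S') (\<lambda>\<tau>. inj_on \<tau> S' \<and> (\<forall>f\<in>S'. \<tau> f \<le> s) \<and>
              k - b e s \<le> card (B \<inter> running_optima opt a t S' \<tau>))"
            using S' by (intro pred_intros_logic pred_intros_finite pred_inj_on_arrival
              pred_card_running_optima) auto
          then show ?thesis unfolding pred_def .
        qed
        have "emeasure (arrival_measure S') ?X \<le> emeasure (arrival_measure S') ?Y"
          by (rule emeasure_mono[OF _ Y]) (use XY in blast)
        also have "\<dots> \<le> ennreal (s ^ n * q (k - b e s) s)"
          using Suc.hyps(1)[of S' s "k - b e s"] S' True Suc.prems by (simp add: q_def)
        finally show ?thesis using True Suc.prems by simp
      next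
        case False
        then have "?X = {} \<or> s \<notin> {0..1}" using XY by fastforce
        then show ?thesis
        proof
          assume X: "?X = {}"
          show ?thesis unfolding X by simp
        qed simp
      qed
    qed
    finally show ?thesis .
  qed
  have "emeasure ?M {\<tau>\<in>space ?M. inj_on \<tau> S \<and> (\<forall>f\<in>S. \<tau> f \<le> T) \<and>
        k \<le> card (B \<inter> running_optima opt a t S \<tau>)} \<le> emeasure ?M (\<Union>e\<in>S. A e)"
  proof (rule emeasure_mono)
    have ne: "S \<noteq> {}" using Suc.hyps(2) by auto
    have "\<exists>e\<in>S. \<forall>f\<in>S. \<tau> f \<le> \<tau> e" for \<tau> :: "'a \<Rightarrow> real"
    proof -
      have "Max (\<tau> ` S) \<in> \<tau> ` S" using S ne by (intro Max_in) auto
      then obtain e where "e \<in> S" "\<tau> e = Max (\<tau> ` S)" by auto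
      then show ?thesis using S by (intro bexI[of _ e]) auto
    qed
    then show "{\<tau>\<in>space ?M. inj_on \<tau> S \<and> (\<forall>f\<in>S. \<tau> f \<le> T) \<and>
        k \<le> card (B \<inter> running_optima opt a t S \<tau>)} \<subseteq> (\<Union>e\<in>S. A e)"
      unfolding A_def by blast
    show "(\<Union>e\<in>S. A e) \<in> sets ?M" using A_sets S by auto
  qed
  also have "\<dots> \<le> (\<Sum>e\<in>S. emeasure ?M (A e))"
    using A_sets S by (intro emeasure_subadditive_finite) auto
  also have "\<dots> \<le> (\<Sum>e\<in>S. \<integral>\<^sup>+s. ennreal (s ^ n * q (k - b e s) s) * indicator {0..T} s \<partial>lborel)"
    by (intro sum_mono A_le)
  also have "\<dots> = (\<integral>\<^sup>+s. (\<Sum>e\<in>S. ennreal (s ^ n * q (k - b e s) s) * indicator {0..T} s) \<partial>lborel)"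
  proof (rule nn_integral_sum[symmetric])
    fix e
    have qm: "(\<lambda>s. q j s) \<in> borel_measurable borel" for j
      unfolding q_def window_mean_def
      by (intro borel_measurable_continuous_onI continuous_intros) (use a in \<open>auto simp: max_def\<close>)
    have "(\<lambda>s. q (k - b e s) s) = (\<lambda>s. if a < s \<and> s < t \<and> e \<in> opt S \<inter> B then q (k - 1) s else q k s)"
      by (auto simp: b_def)
    also have "\<dots> \<in> borel_measurable borel" using qm by measurable
    finally have "(\<lambda>s. q (k - b e s) s) \<in> borel_measurable lborel" by (simp only: measurable_lborel2)
    moreover have "(\<lambda>s :: real. s) \<in> borel_measurable lborel" "{0..T} \<in> sets lborel" by simp_all
    ultimately show "(\<lambda>s. ennreal (s ^ n * q (k - b e s) s) * indicator {0..T} s) \<in> borel_measurable lborel"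
      by (intro borel_measurable_times_ennreal measurable_compose[OF _ measurable_ennreal]
        borel_measurable_times borel_measurable_power borel_measurable_indicator)
  qed
  also have "\<dots> \<le> (\<integral>\<^sup>+s. ennreal (s ^ n * (real (Suc n) * q k s +
      (if a < s \<and> s < t then real c * (q (k - 1) s - q k s) else 0))) * indicator {0..T} s \<partial>lborel)"
  proof (rule nn_integral_mono)
    fix s :: real
    have "(\<Sum>e\<in>S. q (k - b e s) s)
        \<le> real (Suc n) * q k s + (if a < s \<and> s < t then real c * (q (k - 1) s - q k s) else 0)"
    proof (cases "a < s \<and> s < t")
      case True
      \<comment> \<open>Counted elements exchange \<open>q k\<close> for the larger
        \<open>q (k - 1)\<close>; there are at most \<open>c\<close> of them, whichever they
        are.\<close>
      have "(\<Sum>e\<in>S. q (k - b e s) s) = (\<Sum>e\<in>S. q k s + (if e \<in> opt S \<inter> B then q (k - 1) s - q k s else 0))"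
        using True by (intro sum.cong) (auto simp: b_def)
      also have "\<dots> = real (card S) * q k s + real (card (S \<inter> (opt S \<inter> B))) * (q (k - 1) s - q k s)"
        unfolding sum.distrib sum.inter_restrict[OF S(1), symmetric] by simp
      also have "\<dots> \<le> real (card S) * q k s + real c * (q (k - 1) s - q k s)"
        using opt[OF S(2)] q1[of k s] by (intro add_left_mono mult_right_mono) (auto simp: Int_assoc)
      finally show ?thesis using True Suc.hyps(2) by simp
    next
      case False
      then have "b e s = 0" for e by (auto simp: b_def)
      then show ?thesis using False Suc.hyps(2) by auto
    qed
    then have "s ^ n * (\<Sum>e\<in>S. q (k - b e s) s) \<le> s ^ n * (real (Suc n) * q k s +
        (if a < s \<and> s < t then real c * (q (k - 1) s - q k s) else 0))" if "0 \<le> s"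
      using that by (intro mult_left_mono) auto
    moreover have "(\<Sum>e\<in>S. ennreal (s ^ n * q (k - b e s) s)) = ennreal (s ^ n * (\<Sum>e\<in>S. q (k - b e s) s))"
      if "0 \<le> s" using that q0 by (simp add: sum_distrib_left sum_ennreal)
    ultimately show "(\<Sum>e\<in>S. ennreal (s ^ n * q (k - b e s) s) * indicator {0..T} s)
      \<le> ennreal (s ^ n * (real (Suc n) * q k s +
      (if a < s \<and> s < t then real c * (q (k - 1) s - q k s) else 0))) * indicator {0..T} s"
      by (auto simp: indicator_def intro!: ennreal_leI)
  qed
  also have "\<dots> = ennreal (T ^ card S * poisson_tail k (window_mean a t c T))"
  proof (rule nn_integral_has_integral_lebesgue')
    fix s assume "s \<in> {0..T}"
    then show "0 \<le> s ^ n * (real (Suc n) * q k s +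
      (if a < s \<and> s < t then real c * (q (k - 1) s - q k s) else 0))"
      using q0[of k s] q1[of k s] by (auto intro!: mult_nonneg_nonneg add_nonneg_nonneg)
  next
    show "((\<lambda>s. s ^ n * (real (Suc n) * q k s +
      (if a < s \<and> s < t then real c * (q (k - 1) s - q k s) else 0)))
      has_integral T ^ card S * poisson_tail k (window_mean a t c T)) {0..T}"
      using has_integral_poisson_tail_recursion[OF a \<open>0 \<le> T\<close> zero_less_Suc, of n k c]
      unfolding q_def Suc.hyps(2)[symmetric] by (simp only: diff_Suc_1)
  qed
  finally show ?case .
qed

subsection \<open>Success probability of the greedy algorithm\<close>

text \<open>The space of \<open>arrival_measure\<close> contains functions with arbitrary real
  values, so the bounds hold only almost everywhere.\<close>

lemma AE_arrival_bounds:
  assumes "finite E"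
  shows "AE \<tau> in arrival_measure E. \<forall>f\<in>E. \<tau> f \<in> {0..1}"
proof (rule AE_finite_allI[OF assms])
  fix f assume "f \<in> E"
  have "AE s in unif. s \<in> {0..1}" by (rule AE_uniform_measureI) auto
  then show "AE \<tau> in arrival_measure E. \<tau> f \<in> {0..1}"
    unfolding arrival_measure_def using \<open>f \<in> E\<close>
    by (intro AE_PiM_component prob_space_unif)
qed

text \<open>With all other times fixed, a tie confines the time of \<open>a\<close> to the single
  point \<open>\<tau> b\<close>, a null set.\<close>

lemma AE_arrival_distinct:
  assumes E: "finite E" "a \<in> E" "b \<in> E" "a \<noteq> b"
  shows "AE \<tau> in arrival_measure E. \<tau> a \<noteq> \<tau> b"
proof (rule AE_I)
  define S where "S = E - {a}"
  have S: "E = insert a S" "finite S" "a \<notin> S" "b \<in> S" using E by (auto simp: S_def)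
  define N where "N = {\<tau>\<in>space (arrival_measure E). \<tau> a = \<tau> b}"
  show N: "N \<in> sets (arrival_measure E)"
    unfolding N_def using E by (intro borel_measurable_eq measurable_arrival_component)
  have ME: "arrival_measure E = (\<Pi>\<^sub>M i\<in>insert a S. unif)"
    by (simp only: arrival_measure_def S(1))
  have "emeasure (arrival_measure E) N = (\<integral>\<^sup>+\<tau>. indicator N \<tau> \<partial>(\<Pi>\<^sub>M i\<in>insert a S. unif))"
    using nn_integral_indicator[OF N] unfolding ME by (rule sym)
  also have "\<dots> = (\<integral>\<^sup>+\<tau>. \<integral>\<^sup>+s. indicator N (\<tau>(a := s)) \<partial>unif \<partial>(\<Pi>\<^sub>M i\<in>S. unif))"
    by (rule unif.product_nn_integral_insert[OF S(2,3) borel_measurable_indicator[OF N[unfolded ME]]])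
  also have "\<dots> = (\<integral>\<^sup>+\<tau>. 0 \<partial>(\<Pi>\<^sub>M i\<in>S. unif))"
  proof (intro nn_integral_cong)
    fix \<tau> :: "'a \<Rightarrow> real"
    have "AE s in lborel. s \<noteq> \<tau> b" by (rule AE_lborel_singleton)
    then have "AE s in unif. s \<noteq> \<tau> b"
      by (intro AE_uniform_measureI) (auto elim: AE_mp)
    then have "AE s in unif. indicator N (\<tau>(a := s)) = (0 :: ennreal)"
      by eventually_elim (use E(4) in \<open>auto simp: N_def indicator_def\<close>)
    then have "(\<integral>\<^sup>+s. indicator N (\<tau>(a := s)) \<partial>unif) = (\<integral>\<^sup>+s. 0 \<partial>unif)"
      by (rule nn_integral_cong_AE)
    then show "(\<integral>\<^sup>+s. indicator N (\<tau>(a := s)) \<partial>unif) = 0" by simp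
  qed
  finally show "emeasure (arrival_measure E) N = 0" by simp
  show "{\<tau>\<in>space (arrival_measure E). \<not> \<tau> a \<noteq> \<tau> b} \<subseteq> N" by (auto simp: N_def)
qed

lemma AE_arrival_inj_on:
  assumes "finite E"
  shows "AE \<tau> in arrival_measure E. inj_on \<tau> E"
proof -
  have "AE \<tau> in arrival_measure E. \<forall>a\<in>E. \<forall>b\<in>E - {a}. \<tau> a \<noteq> \<tau> b"
    using assms by (intro AE_finite_allI AE_arrival_distinct) auto
  then show ?thesis by (rule AE_mp) (auto simp: inj_on_def)
qed

text \<open>Even where ties are broken by choice, greedy depends on the arrival times only through finitely
  many comparisons.\<close>

lemma pred_greedy:
  assumes fin: "finite E"
  shows "Measurable.pred (arrival_measure E) (\<lambda>\<tau>. e \<in> greedy t\<^sub>0 E \<I> w \<tau>)"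
proof -
  let ?M = "arrival_measure E"
  define R :: "('a \<Rightarrow> real) \<Rightarrow> _" where "R \<tau> = {p\<in>E \<times> E. \<tau> (fst p) \<le> \<tau> (snd p)}" for \<tau>
  define L :: "('a \<Rightarrow> real) \<Rightarrow> _" where "L \<tau> = {f\<in>E. t\<^sub>0 < \<tau> f}" for \<tau>
  define P :: "('a \<Rightarrow> real) \<Rightarrow> _" where "P \<tau> = {f\<in>E. 0 \<le> \<tau> f}" for \<tau>
  \<comment> \<open>\<open>Q\<close> reads the outcome off the three finite sets through any
    representative; \<open>greedy_cong\<close> makes the choice immaterial.\<close>
  define Q where "Q r l p \<longleftrightarrow> (\<exists>\<tau>. R \<tau> = r \<and> L \<tau> = l \<and> P \<tau> = p \<and> e \<in> greedy t\<^sub>0 E \<I> w \<tau>)" for r l p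
  have "e \<in> greedy t\<^sub>0 E \<I> w \<tau> \<longleftrightarrow> Q (R \<tau>) (L \<tau>) (P \<tau>)" for \<tau>
  proof
    assume "Q (R \<tau>) (L \<tau>) (P \<tau>)"
    then obtain \<tau>' where \<tau>': "R \<tau>' = R \<tau>" "L \<tau>' = L \<tau>" "P \<tau>' = P \<tau>" "e \<in> greedy t\<^sub>0 E \<I> w \<tau>'"
      by (auto simp: Q_def)
    have "greedy t\<^sub>0 E \<I> w \<tau> = greedy t\<^sub>0 E \<I> w \<tau>'"
    proof (rule greedy_cong[OF fin])
      show "\<tau> x \<le> \<tau> y \<longleftrightarrow> \<tau>' x \<le> \<tau>' y" if "x \<in> E" "y \<in> E" for x y
        using \<tau>'(1) that by (auto simp: R_def set_eq_iff)
      show "t\<^sub>0 < \<tau> x \<longleftrightarrow> t\<^sub>0 < \<tau>' x" if "x \<in> E" for x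
        using \<tau>'(2) that by (auto simp: L_def)
      show "0 \<le> \<tau> x \<longleftrightarrow> 0 \<le> \<tau>' x" if "x \<in> E" for x
        using \<tau>'(3) that by (auto simp: P_def)
    qed
    with \<tau>'(4) show "e \<in> greedy t\<^sub>0 E \<I> w \<tau>" by simp
  qed (auto simp: Q_def)
  moreover have "Measurable.pred ?M (\<lambda>\<tau>. Q (R \<tau>) (L \<tau>) (P \<tau>))"
  proof -
    have R: "R \<in> ?M \<rightarrow>\<^sub>M count_space UNIV"
      unfolding R_def using fin by (intro measurable_Collect_finite pred_arrival_le) auto
    have L: "L \<in> ?M \<rightarrow>\<^sub>M count_space UNIV"
      unfolding L_def pred_def using fin
      by (intro measurable_Collect_finite) (auto simp: pred_def intro!: borel_measurable_less)
    have P: "P \<in> ?M \<rightarrow>\<^sub>M count_space UNIV"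
      unfolding P_def using fin
      by (intro measurable_Collect_finite) (auto simp: pred_def intro!: borel_measurable_le)
    have eq: "Measurable.pred ?M (\<lambda>\<tau>. F \<tau> = x)" if "F \<in> ?M \<rightarrow>\<^sub>M count_space UNIV"
      for F :: "('a \<Rightarrow> real) \<Rightarrow> 'b" and x
      using that by (rule measurable_compose[where g = "\<lambda>y. y = x"]) simp
    have "Measurable.pred ?M (\<lambda>\<tau>. \<exists>r\<in>Pow (E \<times> E). \<exists>l\<in>Pow E. \<exists>p\<in>Pow E.
        R \<tau> = r \<and> L \<tau> = l \<and> P \<tau> = p \<and> Q r l p)"
      using fin by (intro pred_intros_finite pred_intros_logic eq R L P) auto
    moreover have "R \<tau> \<in> Pow (E \<times> E)" "L \<tau> \<in> Pow E" "P \<tau> \<in> Pow E" for \<tau>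
      by (auto simp: R_def L_def P_def)
    ultimately show ?thesis by simp
  qed
  ultimately show ?thesis by simp
qed

text \<open>Up to a null set, the event \<open>G\<close> implies that \<open>e\<close> is selected.
  Given the arrival time \<open>s\<close> of \<open>e\<close>, the failure of \<open>G\<close> is
  bounded by a union over the blocking sets, and the resulting bound is integrated over
  \<open>s\<close>.\<close>

lemma success_probability_ge:
  assumes lm: "laminar_matroid E \<I>" and pos: "\<And>x. x \<in> E \<Longrightarrow> w x > 0" and inj: "inj_on w E"
    and e: "e \<in> max_weight_indep \<I> w E"
  shows "1 / 4.75 \<le> \<P>(\<tau> in arrival_measure E. e \<in> greedy 0.7 E \<I> w \<tau>)"
proof -
  have M: "matroid E \<I>" using lm by (rule laminar_matroid_imp_matroid)
  obtain \<F> c where fin: "finite E" and lam: "laminar_family E \<F>" and I: "\<I> = laminar_indep E \<F> c"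
    using lm unfolding laminar_matroid_def by blast
  interpret prob_space "arrival_measure E" by (rule prob_space_arrival_measure)
  let ?opt = "max_weight_indep \<I> w"
  have eE: "e \<in> E" using e max_weight_indep_subset[OF M] by blast
  have "{e} \<in> \<I>" using e max_weight_indep_in[OF M, of w E] M unfolding matroid_def by blast
  then obtain K :: "nat set" and D where K: "finite K" "0 \<notin> K"
    and D: "\<And>k S. k \<in> K \<Longrightarrow> S \<in> \<I> \<Longrightarrow> card (S \<inter> D k) \<le> k"
    and ins: "\<And>A. A \<in> \<I> \<Longrightarrow> (\<And>k. k \<in> K \<Longrightarrow> card (A \<inter> D k) < k) \<Longrightarrow> insert e A \<in> \<I>"
    using laminar_blocking_sets[OF fin lam I] by metis
  define S where "S = E - {e}"
  have S: "E = insert e S" "finite S" "e \<notin> S" "S \<subseteq> E" using fin eE by (auto simp: S_def)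
  \<comment> \<open>Outcomes with ties in \<open>S\<close> are not treated as blocked: for fixed
    \<open>\<tau> e > 0.7\<close> the complement of \<open>G\<close> is then the union of the events
    \<open>X k\<close>, which contain injectivity as in
    \<open>emeasure_running_optima_le\<close>.\<close>
  define G where "G = {\<tau>\<in>space (arrival_measure E). 0.7 < \<tau> e \<and>
    (\<forall>k\<in>K. \<not> (inj_on \<tau> S \<and> k \<le> card (D k \<inter> running_optima ?opt 0.7 (\<tau> e) S \<tau>)))}"
  have G_sets: "G \<in> sets (arrival_measure E)"
  proof -
    have e_meas: "(\<lambda>\<tau>. \<tau> e) \<in> borel_measurable (arrival_measure E)"
      using eE by (rule measurable_arrival_component)
    have "Measurable.pred (arrival_measure E) (\<lambda>\<tau>. 0.7 < \<tau> e)"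
      unfolding pred_def by (intro borel_measurable_less e_meas borel_measurable_const)
    then have "Measurable.pred (arrival_measure E) (\<lambda>\<tau>. 0.7 < \<tau> e \<and>
      (\<forall>k\<in>K. \<not> (inj_on \<tau> S \<and> k \<le> card (D k \<inter> running_optima ?opt 0.7 (\<tau> e) S \<tau>))))"
      using K(1) S(2,4) by (intro pred_intros_logic pred_intros_finite pred_inj_on_arrival
        pred_card_running_optima e_meas)
    then show ?thesis unfolding G_def pred_def .
  qed
  have "AE \<tau> in arrival_measure E. \<tau> \<in> G \<longrightarrow> e \<in> greedy 0.7 E \<I> w \<tau>"
    using AE_arrival_bounds[OF fin] AE_arrival_inj_on[OF fin]
  proof eventually_elim
    case (elim \<tau>)
    show ?case
    proof
      assume G: "\<tau> \<in> G"
      have "inj_on \<tau> S" using elim(2) S(4) by (rule inj_on_subset)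
      then have less: "card (D k \<inter> running_optima ?opt 0.7 (\<tau> e) S \<tau>) < k" if "k \<in> K" for k
        using G that by (auto simp: G_def not_le)
      show "e \<in> greedy 0.7 E \<I> w \<tau>"
      proof (rule greedy_selects[OF M eE _ elim(2)])
        show "e \<in> ?opt (arrived E \<tau> (\<tau> e))"
          using elim(1) eE
          by (intro max_weight_indep_restrict[OF M pos inj e]) (auto simp: arrived_def)
        show "0.7 < \<tau> e" using G by (simp add: G_def)
        fix A assume A: "A \<in> \<I>" "A \<subseteq> running_optima ?opt 0.7 (\<tau> e) (E - {e}) \<tau>"
        show "insert e A \<in> \<I>"
        proof (rule ins[OF A(1)])
          fix k assume k: "k \<in> K"
          have "finite (running_optima ?opt 0.7 (\<tau> e) S \<tau>)"
            using S(2) by (simp add: running_optima_def)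
          then have "card (A \<inter> D k) \<le> card (D k \<inter> running_optima ?opt 0.7 (\<tau> e) S \<tau>)"
            using A(2) by (intro card_mono) (auto simp: S_def)
          with less[OF k] show "card (A \<inter> D k) < k" by simp
        qed
      qed (use elim(1) in auto)
    qed
  qed
  then have "prob G \<le> \<P>(\<tau> in arrival_measure E. e \<in> greedy 0.7 E \<I> w \<tau>)"
    using pred_greedy[OF fin, of e "0.7" \<I> w] G_sets
    by (intro finite_measure_mono_AE) (auto simp: pred_def G_def elim!: AE_mp)
  moreover have "1 / 4.75 \<le> prob G"
  proof -
    define g :: "real \<Rightarrow> real" where "g s = 3 / 2 - 1 / (2 * (1 - ln (s / 0.7)) ^ 2)" for s
    obtain I0 where I0: "(g has_integral I0) {0.7..1}" "1 / 4.75 \<le> I0"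
      unfolding g_def using integral_success_probability_ge by blast
    have slice: "ennreal (g s) \<le> emeasure (arrival_measure S) {\<tau>\<in>space (arrival_measure S). \<tau>(e := s) \<in> G}"
      if s: "0.7 < s" "s \<le> 1" for s
    proof -
      interpret S: prob_space "arrival_measure S" by (rule prob_space_arrival_measure)
      define l where "l = ln (s / 0.7)"
      have l: "0 \<le> l" "l < 1" using ln_over_threshold_bounds[of s] s by (auto simp: l_def)
      define X where "X k = {\<tau>\<in>space (arrival_measure S). inj_on \<tau> S \<and>
        k \<le> card (D k \<inter> running_optima ?opt 0.7 s S \<tau>)}" for k
      have X_sets: "X k \<in> S.events" for k
      proof -
        have "Measurable.pred (arrival_measure S) (\<lambda>\<tau>. inj_on \<tau> S \<and>
            k \<le> card (D k \<inter> running_optima ?opt 0.7 s S \<tau>))"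
          using S by (intro pred_intros_logic pred_inj_on_arrival pred_card_running_optima) auto
        then show ?thesis unfolding X_def pred_def .
      qed
      have X_le: "S.prob (X k) \<le> poisson_tail k (real k * l)" if k: "k \<in> K" for k
      proof -
        let ?Y = "{\<tau>\<in>space (arrival_measure S). inj_on \<tau> S \<and> (\<forall>f\<in>S. \<tau> f \<le> 1) \<and>
          k \<le> card (D k \<inter> running_optima ?opt 0.7 s S \<tau>)}"
        have Y: "?Y \<in> S.events"
        proof -
          have "Measurable.pred (arrival_measure S) (\<lambda>\<tau>. \<tau> f \<le> 1)" if "f \<in> S" for f
            unfolding pred_def using that by (intro borel_measurable_le measurable_arrival_component) auto
          then have "Measurable.pred (arrival_measure S) (\<lambda>\<tau>. inj_on \<tau> S \<and> (\<forall>f\<in>S. \<tau> f \<le> 1) \<and>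
              k \<le> card (D k \<inter> running_optima ?opt 0.7 s S \<tau>))"
            using S by (intro pred_intros_logic pred_intros_finite pred_inj_on_arrival
              pred_card_running_optima) auto
          then show ?thesis unfolding pred_def .
        qed
        \<comment> \<open>All arrival times are at most 1 almost everywhere; adding this condition
          gives the event of \<open>emeasure_running_optima_le\<close> at
          \<open>T = 1\<close>.\<close>
        have "emeasure (arrival_measure S) (X k) \<le> emeasure (arrival_measure S) ?Y"
          using AE_arrival_bounds[OF S(2)] Y
          by (intro emeasure_mono_AE) (auto simp: X_def elim!: AE_mp)
        also have "\<dots> \<le> ennreal (1 ^ card S * poisson_tail k (window_mean 0.7 s k 1))"
        proof (rule emeasure_running_optima_le[where E = E])
          fix S' assume "S' \<subseteq> E"
          have "S' \<inter> ?opt S' \<inter> D k = ?opt S' \<inter> D k" using max_weight_indep_subset[OF M] by blast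
          then show "card (S' \<inter> ?opt S' \<inter> D k) \<le> k"
            using D[OF k max_weight_indep_in[OF M]] by simp
        qed (use s S in auto)
        also have "window_mean 0.7 s k 1 = real k * l"
          using s by (simp add: window_mean_def l_def min_def max_def)
        finally show ?thesis
          using l by (simp add: S.emeasure_eq_measure poisson_tail_nonneg)
      qed
      have "g s = 1 - (1 / (1 - l) ^ 2 - 1) / 2"
        unfolding g_def l_def[symmetric] by (simp add: field_simps)
      also have "\<dots> \<le> 1 - (\<Sum>k\<in>K. poisson_tail k (real k * l))"
        using sum_poisson_tail_le[OF K l] by simp
      also have "\<dots> \<le> 1 - (\<Sum>k\<in>K. S.prob (X k))"
        using X_le by (intro diff_left_mono sum_mono) auto
      also have "\<dots> \<le> 1 - S.prob (\<Union>k\<in>K. X k)"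
        using K X_sets by (intro diff_left_mono S.finite_measure_subadditive_finite) auto
      also have "\<dots> = S.prob (space (arrival_measure S) - (\<Union>k\<in>K. X k))"
        using K X_sets by (intro S.prob_compl[symmetric]) auto
      also have "space (arrival_measure S) - (\<Union>k\<in>K. X k) = {\<tau>\<in>space (arrival_measure S). \<tau>(e := s) \<in> G}"
      proof -
        \<comment> \<open>The time of \<open>e\<close> enters only as the end \<open>s\<close> of
          the window, so the slice of \<open>G\<close> is the complement of the blocking
          events.\<close>
        have "inj_on (\<tau>(e := s)) S \<longleftrightarrow> inj_on \<tau> S"
          "running_optima ?opt 0.7 s S (\<tau>(e := s)) = running_optima ?opt 0.7 s S \<tau>" for \<tau>
        proof -
          have upd: "(\<tau>(e := s)) f = \<tau> f" if "f \<in> S" for f using that S(3) by auto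
          then show "inj_on (\<tau>(e := s)) S \<longleftrightarrow> inj_on \<tau> S" by (rule inj_on_cong)
          show "running_optima ?opt 0.7 s S (\<tau>(e := s)) = running_optima ?opt 0.7 s S \<tau>"
            unfolding running_optima_def using upd by (auto simp del: fun_upd_apply cong: conj_cong)
        qed
        moreover have "\<tau>(e := s) \<in> space (arrival_measure E)" if "\<tau> \<in> space (arrival_measure S)" for \<tau>
          using that unfolding S(1) by (auto simp: space_arrival_measure extensional_def)
        ultimately show ?thesis
          using s by (auto simp: G_def X_def)
      qed
      finally have "ennreal (g s) \<le> ennreal (S.prob {\<tau>\<in>space (arrival_measure S). \<tau>(e := s) \<in> G})"
        by (rule ennreal_leI)
      then show ?thesis by (simp add: S.emeasure_eq_measure)
    qed
    have "ennreal (1 / 4.75) \<le> ennreal I0" using I0 by (intro ennreal_leI)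
    also have "\<dots> = (\<integral>\<^sup>+s. ennreal (g s) * indicator {0.7..1} s \<partial>lborel)"
    proof (rule nn_integral_has_integral_lebesgue'[symmetric, OF _ I0(1)])
      fix s :: real assume "s \<in> {0.7..1}"
      \<comment> \<open>Here \<open>1 - 0.3567 \<ge> 0.64\<close>, and
        \<open>1 / (2 * 0.64^2)\<close> is below \<open>3 / 2\<close>; nonnegativity of
        \<open>g\<close> allows its integral to be read as a nonnegative Lebesgue integral.\<close>
      from ln_over_threshold_bounds[OF this] have "0.64 ^ 2 \<le> (1 - ln (s / 0.7)) ^ 2"
        by (intro power_mono) auto
      then have "1 / (2 * (1 - ln (s / 0.7)) ^ 2) \<le> 1 / (2 * 0.64 ^ 2)"
        by (intro divide_left_mono mult_left_mono mult_pos_pos) (auto simp: power2_eq_square)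
      also have "\<dots> \<le> 3 / 2" by (simp add: power2_eq_square)
      finally show "0 \<le> g s" by (simp add: g_def)
    qed
    also have "\<dots> \<le> (\<integral>\<^sup>+s. emeasure (arrival_measure S) {\<tau>\<in>space (arrival_measure S). \<tau>(e := s) \<in> G}
        * indicator {0..1} s \<partial>lborel)"
    proof (rule nn_integral_mono_AE)
      show "AE s in lborel. ennreal (g s) * indicator {0.7..1} s
        \<le> emeasure (arrival_measure S) {\<tau>\<in>space (arrival_measure S). \<tau>(e := s) \<in> G} * indicator {0..1} s"
        \<comment> \<open>The slice bound needs \<open>s > 0.7\<close>; the endpoint is a null
          set.\<close>
        using AE_lborel_singleton[of "0.7 :: real"]
        by eventually_elim (use slice in \<open>auto simp: indicator_def\<close>)
    qed
    also have "\<dots> = emeasure (arrival_measure E) G"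
      using emeasure_arrival_insert[OF S(2,3)] G_sets unfolding S(1) by simp
    finally show ?thesis by (simp add: emeasure_eq_measure)
  qed
  ultimately show ?thesis by linarith
qed

theorem theorem1:
  shows "(\<forall>(E :: 'a set) \<I> w. laminar_matroid E \<I> \<longrightarrow>
            (\<forall>e\<in>E. w e > 0) \<longrightarrow> inj_on w E \<longrightarrow>
            (\<forall>e\<in>max_weight_indep \<I> w E.
               \<P>(\<tau> in arrival_measure E. e \<in> greedy 0.7 E \<I> w \<tau>) \<ge> 1 / 4.75))
       \<and> probability_competitive (laminar_matroid :: 'a set \<Rightarrow> 'a set set \<Rightarrow> bool) 4.75 (greedy 0.7)"
proof
  show *: "\<forall>(E :: 'a set) \<I> w. laminar_matroid E \<I> \<longrightarrow>
      (\<forall>e\<in>E. w e > 0) \<longrightarrow> inj_on w E \<longrightarrow>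
      (\<forall>e\<in>max_weight_indep \<I> w E.
         \<P>(\<tau> in arrival_measure E. e \<in> greedy 0.7 E \<I> w \<tau>) \<ge> 1 / 4.75)"
  proof (intro allI impI ballI)
    fix E :: "'a set" and \<I> w e
    assume h: "laminar_matroid E \<I>" "\<forall>e\<in>E. w e > 0" "inj_on w E" "e \<in> max_weight_indep \<I> w E"
    show "\<P>(\<tau> in arrival_measure E. e \<in> greedy 0.7 E \<I> w \<tau>) \<ge> 1 / 4.75"
      by (rule success_probability_ge[OF h(1) bspec[OF h(2)] h(3,4)])
  qed
  show "probability_competitive (laminar_matroid :: 'a set \<Rightarrow> 'a set set \<Rightarrow> bool) 4.75 (greedy 0.7)"
    unfolding probability_competitive_def weight_function_def
  proof (intro allI impI)
    fix E :: "'a set" and \<I> and w :: "'a \<Rightarrow> real"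
    assume "laminar_matroid E \<I>" "(\<forall>e\<in>E. w e > 0) \<and> inj_on w E"
    with * show "\<forall>e\<in>max_weight_indep \<I> w E.
        \<P>(\<tau> in arrival_measure E. e \<in> greedy 0.7 E \<I> w \<tau>) \<ge> 1 / 4.75"
      by iprover
  qed
qed

end
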